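(* Assume that $\delta^\star:=\min_{1\le i,j\le K}Q_\star(i,j)>0$ and that $\pi^\star$ is the stationary distribution of $Q_\star$. Then for all $1\le k\le n$ and all $y_{1:n}=(y_1,\dots,y_n)\in\mathcal Y^n$, $$\|\phi^\star_{k|n}(\cdot,y_{1:n})-\widehat\phi_{k|n}(\cdot,y_{1:n})\|_{\mathrm{tv}}\le C_\star\Big(\rho_\star^{k-1}\|\pi^\star-\widehat\pi\|_2/\delta^\star+\big[1/(1-\rho_\star)+1/(1-\widehat\rho)\big]\|Q_\star-\widehat Q\|_F/\delta^\star+\sum_{\ell=1}^n(\widehat\rho\vee\rho_\star)^{|\ell-k|}c_\star^{-1}(y_\ell)\max_{x\in\mathcal X}|f^\star_x(y_\ell)-\widehat f_x(y_\ell)|\Big),$$ where $\rho_\star:=1-\delta^\star/(1-\delta^\star)$, $C_\star:=4(1-\delta^\star)/\delta^\star$, $\widehat\delta:=\min_{x,x'}\widehat Q(x,x')$ and $\widehat\rho:=1-\widehat\delta/(1-\widehat\delta)$.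
   Context: Setting. $K\ge2$ is an integer, $\mathcal X=\{1,\dots,K\}$, $\mathcal Y\subset\mathbb R^D$. $Q_\star$ is a $K\times K$ transition matrix, $\pi^\star$ a probability vector on $\mathcal X$, and for $x\in\mathcal X$, $f^\star_x:\mathcal Y\to[0,\infty)$ is a probability density with respect to Lebesgue measure on $\mathcal Y$; these are the parameters of a hidden Markov model. $\widehat\pi$, $\widehat Q$, $(\widehat f_x)_{x\in\mathcal X}$ are estimators of them: a probability vector, a transition matrix and nonnegative functions on $\mathcal Y$. For $y\in\mathcal Y$, $c_\star(y):=\min_{x\in\mathcal X}\sum_{x'\in\mathcal X}Q_\star(x,x')f^\star_{x'}(y)$. Filtering distributions: $$\phi^\star_1(x,y_1)=\frac{\pi^\star(x)f^\star_x(y_1)}{\sum_{x'}\pi^\star(x')f^\star_{x'}(y_1)},\qquad \phi^\star_k(x,y_{1:k})=\frac{\sum_{x'}Q_\star(x',x)f^\star_x(y_k)\phi^\star_{k-1}(x',y_{1:k-1})}{\sum_{x',x''}Q_\star(x',x'')f^\star_{x''}(y_k)\phi^\star_{k-1}(x',y_{1:k-1})}.$$ Marginal smoothing distributions: $\phi^\star_{n|n}(x,y_{1:n})=\phi^\star_n(x,y_{1:n})$ and, for $k<n$, $$\phi^\star_{k|n}(x,y_{1:n})=\sum_{x'\in\mathcal X}B^\star_{\phi^\star_k(\cdot,y_{1:k})}(x',x)\,\phi^\star_{k+1|n}(x',y_{1:n}),\qquad B^\star_{\phi^\star_k(\cdot,y_{1:k})}(u,v)=\frac{Q_\star(v,u)\phi^\star_k(v,y_{1:k})}{\sum_{z}Q_\star(z,u)\phi^\star_k(z,y_{1:k})}.$$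 $\widehat\phi_k$ and $\widehat\phi_{k|n}$ are obtained by the same recursions with $\pi^\star,Q_\star,f^\star$ replaced by $\widehat\pi,\widehat Q,\widehat f$. It is understood that the denominators in these recursions are positive; if $c_\star(y_\ell)=0$ for some $\ell$ or $\widehat\delta=0$, the right-hand side of the bound is read as $+\infty$. $\|\mu-\nu\|_{\mathrm{tv}}=\sum_{x\in\mathcal X}|\mu(x)-\nu(x)|$ is the total variation norm, $\|\cdot\|_2$ the Euclidean norm, $\|\cdot\|_F$ the Frobenius norm, $a\vee b=\max(a,b)$. *)

theory Defs
  imports "HOL-Analysis.Analysis"
begin

text \<open>
  The hidden states \<open>1, \<dots>, K\<close> are the elements of a finite type \<open>'k\<close> with \<open>CARD('k) = K\<close>, and the
  observation space is a subset \<open>Y\<close> of \<open>real ^ 'd\<close>. A family of emission functions is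
  \<open>f :: 'k \<Rightarrow> real ^ 'd \<Rightarrow> real\<close>, and observations \<open>y\<^sub>1, \<dots>, y\<^sub>n\<close> are the values
  \<open>y 1, \<dots>, y n\<close> of a function \<open>y\<close> on \<open>nat\<close>.
\<close>

definition prob_vec :: "real ^ 'k \<Rightarrow> bool" where
  "prob_vec p \<longleftrightarrow> (\<forall>x. 0 \<le> p $ x) \<and> (\<Sum>x\<in>UNIV. p $ x) = 1"

definition transition_matrix :: "real ^ 'k ^ 'k \<Rightarrow> bool" where
  "transition_matrix Q \<longleftrightarrow> (\<forall>x. prob_vec (Q $ x))"

definition stationary :: "real ^ 'k ^ 'k \<Rightarrow> real ^ 'k \<Rightarrow> bool" where
  "stationary Q p \<longleftrightarrow> prob_vec p \<and> p v* Q = p"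

definition prob_density_on :: "(real ^ 'd) set \<Rightarrow> (real ^ 'd \<Rightarrow> real) \<Rightarrow> bool" where
  "prob_density_on Y g \<longleftrightarrow>
     g \<in> borel_measurable (lebesgue_on Y) \<and> (\<forall>y\<in>Y. 0 \<le> g y) \<and>
     (\<integral>\<^sup>+ y. ennreal (g y) \<partial>lebesgue_on Y) = 1"

definition min_entry :: "real ^ 'k ^ 'k \<Rightarrow> real" where
  "min_entry Q = Min {Q $ i $ j | i j. True}"

definition rho :: "real ^ 'k ^ 'k \<Rightarrow> real" where
  "rho Q = 1 - min_entry Q / (1 - min_entry Q)"

definition c_min :: "real ^ 'k ^ 'k \<Rightarrow> ('k \<Rightarrow> real ^ 'd \<Rightarrow> real) \<Rightarrow> real ^ 'd \<Rightarrow> real" where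
  "c_min Q f y = (MIN x. \<Sum>x'\<in>UNIV. Q $ x $ x' * f x' y)"

text \<open>
  \<open>filt_den p Q f y k\<close> is the denominator and \<open>filt p Q f y k x\<close> the value \<open>\<phi>\<^sub>k(x, y\<^sub>1, \<dots>, y\<^sub>k)\<close>
  in the filtering recursion. Time starts at 1; the values at time 0 are dummies.
\<close>

fun filt :: "real ^ 'k \<Rightarrow> real ^ 'k ^ 'k \<Rightarrow> ('k \<Rightarrow> real ^ 'd \<Rightarrow> real) \<Rightarrow> (nat \<Rightarrow> real ^ 'd) \<Rightarrow> nat \<Rightarrow> 'k \<Rightarrow> real"
  and filt_den :: "real ^ 'k \<Rightarrow> real ^ 'k ^ 'k \<Rightarrow> ('k \<Rightarrow> real ^ 'd \<Rightarrow> real) \<Rightarrow> (nat \<Rightarrow> real ^ 'd) \<Rightarrow> nat \<Rightarrow> real"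
where
  "filt p Q f y 0 x = 0"
| "filt p Q f y (Suc 0) x = p $ x * f x (y 1) / filt_den p Q f y (Suc 0)"
| "filt p Q f y (Suc (Suc k)) x =
     (\<Sum>x'\<in>UNIV. Q $ x' $ x * f x (y (Suc (Suc k))) * filt p Q f y (Suc k) x')
       / filt_den p Q f y (Suc (Suc k))"
| "filt_den p Q f y 0 = 1"
| "filt_den p Q f y (Suc 0) = (\<Sum>x'\<in>UNIV. p $ x' * f x' (y 1))"
| "filt_den p Q f y (Suc (Suc k)) =
     (\<Sum>x'\<in>UNIV. \<Sum>x''\<in>UNIV. Q $ x' $ x'' * f x'' (y (Suc (Suc k))) * filt p Q f y (Suc k) x')"

definition back_den :: "real ^ 'k ^ 'k \<Rightarrow> ('k \<Rightarrow> real) \<Rightarrow> 'k \<Rightarrow> real" where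
  "back_den Q \<phi> u = (\<Sum>z\<in>UNIV. Q $ z $ u * \<phi> z)"

definition back_kernel :: "real ^ 'k ^ 'k \<Rightarrow> ('k \<Rightarrow> real) \<Rightarrow> 'k \<Rightarrow> 'k \<Rightarrow> real" where
  "back_kernel Q \<phi> u v = Q $ v $ u * \<phi> v / back_den Q \<phi> u"

text \<open>
  \<open>smooth p Q f y n k x\<close> is \<open>\<phi>\<^bsub>k|n\<^esub>(x, y\<^sub>1, \<dots>, y\<^sub>n)\<close>, for \<open>1 \<le> k \<le> n\<close>.
\<close>

function smooth :: "real ^ 'k \<Rightarrow> real ^ 'k ^ 'k \<Rightarrow> ('k \<Rightarrow> real ^ 'd \<Rightarrow> real) \<Rightarrow> (nat \<Rightarrow> real ^ 'd) \<Rightarrow> nat \<Rightarrow> nat \<Rightarrow> 'k \<Rightarrow> real"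
where
  "smooth p Q f y n k x =
     (if k < n
      then \<Sum>x'\<in>UNIV. back_kernel Q (filt p Q f y k) x' x * smooth p Q f y n (Suc k) x'
      else filt p Q f y n x)"
  by auto
termination
  by (relation "Wellfounded.measure (\<lambda>(p, Q, f, y, n, k, x). n - k)") auto

declare smooth.simps [simp del]

definition denominators_pos ::
  "real ^ 'k \<Rightarrow> real ^ 'k ^ 'k \<Rightarrow> ('k \<Rightarrow> real ^ 'd \<Rightarrow> real) \<Rightarrow> (nat \<Rightarrow> real ^ 'd) \<Rightarrow> nat \<Rightarrow> bool" where
  "denominators_pos p Q f y n \<longleftrightarrow>
     (\<forall>k\<in>{1..n}. filt_den p Q f y k > 0) \<and>
     (\<forall>k\<in>{1..<n}. \<forall>u. back_den Q (filt p Q f y k) u > 0)"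

text \<open>Total variation without the factor \<open>1/2\<close>.\<close>

definition tv_dist :: "('k::finite \<Rightarrow> real) \<Rightarrow> ('k \<Rightarrow> real) \<Rightarrow> real" where
  "tv_dist \<mu> \<nu> = (\<Sum>x\<in>UNIV. \<bar>\<mu> x - \<nu> x\<bar>)"

text \<open>The library norm on \<open>real ^ 'k ^ 'k\<close> is the Frobenius norm.\<close>

lemma norm_matrix_Frobenius:
  fixes A :: "real ^ 'k ^ 'm"
  shows "norm A = sqrt (\<Sum>i\<in>UNIV. \<Sum>j\<in>UNIV. (A $ i $ j)\<^sup>2)"
  by (simp add: norm_vec_def L2_set_def sum_nonneg)

end

theory Submission
  imports Defs
begin

text \<open>
  The smoothing law at time \<open>k\<close> is the marginal of a measure with a product density, one factor for
  each transition and each observation. Replacing a single factor changes the law at the time of that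
  factor by at most twice the relative mass of the change. This error reaches time \<open>k\<close> through the
  forward or the backward smoothing kernels, which are common to both models and satisfy a Doeblin
  minorization with constant \<open>\<delta> / (1 - \<delta>)\<close>, hence contract total variation by \<open>\<rho>\<close>.
\<close>

subsection \<open>Total variation\<close>

text \<open>No positive lower bound on the estimated likelihoods is available, and the estimated
  initial law may have zeros. Each relative error is therefore measured against the mass before the
  replacement, where the replaced factor still belongs to the true model. Hence the bound divides by
  the minimal entry and by \<open>c_min\<close> of the true model, while the estimated transitions
  enter, apart from the differences themselves, only through their contraction rate. Stationarity
  makes the true initial law an average of the rows of the true matrix. It inherits their lower
  bounds and can be treated as one more transition. A changed likelihood costs 2 (1 - d) / d times D
  / c: the 2 comes from renormalizing, (1 - d) / d from the oscillation of the likelihood of the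
  later observations. A changed transition costs 2 \<eta> / d. Both are covered by 4 (1 - d) / d
  because d is at most 1/2, and the geometric sums over the transitions before and after time k give
  the two terms 1 / (1 - \<rho>).\<close>

lemma tv_dist_triangle: "tv_dist a c \<le> tv_dist a b + tv_dist b c"
  unfolding tv_dist_def sum.distrib[symmetric] by (intro sum_mono) auto

lemma tv_dist_telescope:
  fixes S :: "nat \<Rightarrow> 'k::finite \<Rightarrow> real"
  shows "tv_dist (S 0) (S m) \<le> (\<Sum>j<m. tv_dist (S j) (S (Suc j)))"
proof (induction m)
  case 0
  then show ?case by (simp add: tv_dist_def)
next
  case (Suc m)
  then show ?case using tv_dist_triangle[of "S 0" "S (Suc m)" "S m"] by simp
qed

text \<open>The difference splits into \<open>(w x - w' x) / W\<close> and a multiple of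
  \<open>w' x\<close>; after summation the multiple contributes the relative error of the total
  mass, again at most the distance over \<open>W\<close>. Only \<open>W\<close> remains in the
  denominator, so the bound is insensitive to how small the perturbed mass is.\<close>

lemma tv_dist_normalize:
  fixes w w' :: "'k::finite \<Rightarrow> real"
  assumes w': "\<And>x. 0 \<le> w' x" and pos: "0 < sum w UNIV" "0 < sum w' UNIV"
  shows "tv_dist (\<lambda>x. w x / sum w UNIV) (\<lambda>x. w' x / sum w' UNIV) \<le> 2 * tv_dist w w' / sum w UNIV"
proof -
  define W W' where "W = sum w UNIV" and "W' = sum w' UNIV"
  have W: "0 < W" "0 < W'" using pos by (auto simp: W_def W'_def)
  have WW: "\<bar>W - W'\<bar> \<le> tv_dist w w'"
    unfolding W_def W'_def tv_dist_def sum_subtractf[symmetric] by (rule sum_abs)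
  have "\<bar>w x / W - w' x / W'\<bar> \<le> \<bar>w x - w' x\<bar> / W + w' x * (\<bar>W - W'\<bar> / (W * W'))" for x
  proof -
    have "w x / W - w' x / W' = (w x - w' x) / W + w' x * ((W' - W) / (W * W'))"
      using W by (simp add: field_simps)
    also have "\<bar>\<dots>\<bar> \<le> \<bar>(w x - w' x) / W\<bar> + \<bar>w' x * ((W' - W) / (W * W'))\<bar>"
      by (rule abs_triangle_ineq)
    finally show ?thesis
      using W w'[of x] by (simp add: abs_mult abs_minus_commute)
  qed
  then have "tv_dist (\<lambda>x. w x / W) (\<lambda>x. w' x / W')
      \<le> (\<Sum>x\<in>UNIV. \<bar>w x - w' x\<bar> / W + w' x * (\<bar>W - W'\<bar> / (W * W')))"
    unfolding tv_dist_def by (intro sum_mono)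
  also have "\<dots> = tv_dist w w' / W + \<bar>W - W'\<bar> / W"
    using W by (simp add: sum.distrib tv_dist_def W'_def sum_divide_distrib[symmetric] sum_distrib_right[symmetric])
  finally show ?thesis
    using W WW by (simp add: W_def[symmetric] W'_def[symmetric] field_simps)
qed

text \<open>Equal masses make the part \<open>e * \<nu> u\<close>, which is common to all rows,
  cancel in the difference. What remains is a nonnegative kernel with row mass
  \<open>1 - e\<close>.\<close>

lemma tv_dist_contraction:
  fixes P :: "'k::finite \<Rightarrow> 'k \<Rightarrow> real"
  assumes minor: "\<And>x u. e * \<nu> u \<le> P x u" and P: "\<And>x. (\<Sum>u\<in>UNIV. P x u) = 1"
    and \<nu>: "sum \<nu> UNIV = 1" and mass: "sum \<mu> UNIV = sum \<mu>' UNIV"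
  shows "tv_dist (\<lambda>u. \<Sum>x\<in>UNIV. \<mu> x * P x u) (\<lambda>u. \<Sum>x\<in>UNIV. \<mu>' x * P x u) \<le> (1 - e) * tv_dist \<mu> \<mu>'"
proof -
  have "(\<Sum>x\<in>UNIV. \<mu> x * P x u) - (\<Sum>x\<in>UNIV. \<mu>' x * P x u)
      = (\<Sum>x\<in>UNIV. (\<mu> x - \<mu>' x) * (P x u - e * \<nu> u))" for u
    using mass by (simp add: algebra_simps sum.distrib sum_subtractf sum_distrib_left[symmetric] sum_distrib_right[symmetric])
  then have "tv_dist (\<lambda>u. \<Sum>x\<in>UNIV. \<mu> x * P x u) (\<lambda>u. \<Sum>x\<in>UNIV. \<mu>' x * P x u)
      = (\<Sum>u\<in>UNIV. \<bar>\<Sum>x\<in>UNIV. (\<mu> x - \<mu>' x) * (P x u - e * \<nu> u)\<bar>)"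
    unfolding tv_dist_def by simp
  also have "\<dots> \<le> (\<Sum>u\<in>UNIV. \<Sum>x\<in>UNIV. \<bar>\<mu> x - \<mu>' x\<bar> * (P x u - e * \<nu> u))"
    by (intro sum_mono order_trans[OF sum_abs]) (auto simp: abs_mult intro!: sum_mono mult_left_mono minor)
  also have "\<dots> = (\<Sum>x\<in>UNIV. \<bar>\<mu> x - \<mu>' x\<bar> * (\<Sum>u\<in>UNIV. P x u - e * \<nu> u))"
    by (subst sum.swap) (simp add: sum_distrib_left)
  also have "\<dots> = (1 - e) * tv_dist \<mu> \<mu>'"
    by (simp add: sum_subtractf P sum_distrib_left[symmetric] \<nu> tv_dist_def sum_distrib_right[symmetric])
  finally show ?thesis .
qed

subsection \<open>Time-inhomogeneous hidden Markov models\<close>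

text \<open>
  \<open>Q i\<close> moves the hidden state from time \<open>i\<close> to time \<open>i + 1\<close>, and \<open>g i\<close> is the likelihood of the
  observation at time \<open>i\<close>. An initial law \<open>p\<close> is encoded by \<open>Q 0 x = p\<close> for all \<open>x\<close>, so that a change
  of \<open>p\<close> is a change of one transition.
\<close>

primrec fwd :: "(nat \<Rightarrow> 'k \<Rightarrow> 'k \<Rightarrow> real) \<Rightarrow> (nat \<Rightarrow> 'k \<Rightarrow> real) \<Rightarrow> nat \<Rightarrow> 'k \<Rightarrow> real" where
  "fwd Q g 0 = (\<lambda>x. 1)"
| "fwd Q g (Suc j) = (\<lambda>x. (\<Sum>z\<in>UNIV. fwd Q g j z * Q j z x) * g (Suc j) x)"

text \<open>This is the likelihood of the next \<open>m\<close> observations given the state at time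
  \<open>j\<close>. Time grows along the recursion, so the number of remaining steps serves as the
  recursion argument; \<open>bwd\<close> returns to a fixed horizon.\<close>

primrec bwd_steps :: "(nat \<Rightarrow> 'k \<Rightarrow> 'k \<Rightarrow> real) \<Rightarrow> (nat \<Rightarrow> 'k \<Rightarrow> real) \<Rightarrow> nat \<Rightarrow> nat \<Rightarrow> 'k \<Rightarrow> real" where
  "bwd_steps Q g 0 = (\<lambda>j x. 1)"
| "bwd_steps Q g (Suc m) = (\<lambda>j x. \<Sum>u\<in>UNIV. Q j x u * (g (Suc j) u * bwd_steps Q g m (Suc j) u))"

definition bwd :: "(nat \<Rightarrow> 'k \<Rightarrow> 'k \<Rightarrow> real) \<Rightarrow> (nat \<Rightarrow> 'k \<Rightarrow> real) \<Rightarrow> nat \<Rightarrow> nat \<Rightarrow> 'k \<Rightarrow> real" where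
  "bwd Q g n j = bwd_steps Q g (n - j) j"

text \<open>The forward-backward formula for the law of the hidden state at time \<open>k\<close>
  given all \<open>n\<close> observations.\<close>

definition post :: "(nat \<Rightarrow> 'k \<Rightarrow> 'k \<Rightarrow> real) \<Rightarrow> (nat \<Rightarrow> 'k \<Rightarrow> real) \<Rightarrow> nat \<Rightarrow> nat \<Rightarrow> 'k \<Rightarrow> real" where
  "post Q g n k x = fwd Q g k x * bwd Q g n k x / (\<Sum>z\<in>UNIV. fwd Q g k z * bwd Q g n k z)"

text \<open>Only the transitions from time 1 on are strictly positive: \<open>Q 0\<close> encodes an
  initial law, which may have zeros. The last clause says that this law is nevertheless compatible
  with the first observation.\<close>

definition admissible :: "(nat \<Rightarrow> 'k \<Rightarrow> 'k \<Rightarrow> real) \<Rightarrow> (nat \<Rightarrow> 'k \<Rightarrow> real) \<Rightarrow> nat \<Rightarrow> bool" where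
  "admissible Q g n \<longleftrightarrow>
     (\<forall>x u. 0 \<le> Q 0 x u) \<and> (\<forall>i\<ge>1. \<forall>x u. 0 < Q i x u) \<and>
     (\<forall>i\<in>{1..n}. (\<forall>x. 0 \<le> g i x) \<and> (\<exists>x. 0 < g i x)) \<and>
     (\<exists>x u. 0 < Q 0 x u * g 1 u)"

section \<open>Locality and positivity of the forward and backward weights\<close>

lemma bwd_end [simp]: "bwd Q g n n = (\<lambda>x. 1)"
  by (simp add: bwd_def)

lemma bwd_step:
  "j < n \<Longrightarrow> bwd Q g n j x = (\<Sum>u\<in>UNIV. Q j x u * (g (Suc j) u * bwd Q g n (Suc j) u))"
  unfolding bwd_def by (metis Suc_diff_Suc bwd_steps.simps(2))

text \<open>Forward weights see only the past and, by \<open>bwd_cong\<close>, backward weights only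
  the future. This is what lets two different models share a smoothing kernel.\<close>

lemma fwd_cong:
  assumes "\<And>i. i < j \<Longrightarrow> Q i = Q' i" and "\<And>i. 1 \<le> i \<Longrightarrow> i \<le> j \<Longrightarrow> g i = g' i"
  shows "fwd Q g j = fwd Q' g' j"
  using assms by (induction j) auto

lemma bwd_cong:
  assumes "j \<le> n" and "\<And>i. j \<le> i \<Longrightarrow> Q i = Q' i" and "\<And>i. j < i \<Longrightarrow> g i = g' i"
  shows "bwd Q g n j = bwd Q' g' n j"
  using assms
proof (induction j rule: inc_induct)
  case base
  then show ?case by simp
next
  case (step j)
  then have "bwd Q g n (Suc j) = bwd Q' g' n (Suc j)" "Q j = Q' j" "g (Suc j) = g' (Suc j)" by auto
  then show ?case using step.hyps by (intro ext) (simp add: bwd_step)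
qed

lemma fwd_nonneg:
  fixes Q :: "nat \<Rightarrow> 'k::finite \<Rightarrow> 'k \<Rightarrow> real"
  assumes "admissible Q g n" "j \<le> n"
  shows "0 \<le> fwd Q g j x"
  using assms(2)
proof (induction j arbitrary: x)
  case (Suc j)
  have "0 \<le> Q j z x" for z
    using assms(1) unfolding admissible_def by (cases j) (auto intro: less_imp_le)
  moreover have "0 \<le> g (Suc j) x"
    using assms(1) Suc.prems unfolding admissible_def by auto
  ultimately show ?case using Suc by (auto intro!: mult_nonneg_nonneg sum_nonneg)
qed simp

lemma fwd_sum_pos:
  fixes Q :: "nat \<Rightarrow> 'k::finite \<Rightarrow> 'k \<Rightarrow> real"
  assumes adm: "admissible Q g n" and "j \<le> n"
  shows "0 < (\<Sum>x\<in>UNIV. fwd Q g j x)"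
  using assms(2)
proof (induction j)
  case 0
  then show ?case by simp
next
  case (Suc j)
  \<comment> \<open>At time 0 the last clause of \<open>admissible\<close> provides the pair, since
    \<open>Q 0\<close> may have zeros. Later, any state of positive weight reaches any state of
    positive likelihood.\<close>
  have "\<exists>x u. 0 < fwd Q g j x * Q j x u * g (Suc j) u"
  proof (cases "j = 0")
    case True
    then show ?thesis using adm unfolding admissible_def by auto
  next
    case False
    have "\<exists>x. fwd Q g j x \<noteq> 0" using Suc by (metis Suc_leD less_irrefl sum.neutral)
    then obtain x where "0 < fwd Q g j x"
      using fwd_nonneg[OF adm, of j] Suc.prems by (metis Suc_leD less_eq_real_def)
    moreover obtain u where "0 < g (Suc j) u"
      using adm Suc.prems unfolding admissible_def by fastforce
    moreover have "0 < Q j x u" using adm False unfolding admissible_def by auto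
    ultimately show ?thesis by (metis mult_pos_pos)
  qed
  then obtain x u where xu: "0 < fwd Q g j x * Q j x u * g (Suc j) u" by blast
  have Q: "0 \<le> Q j z w" for z w
    using adm unfolding admissible_def by (cases j) (auto intro: less_imp_le)
  have g: "0 \<le> g (Suc j) u" using adm Suc.prems unfolding admissible_def by auto
  have "fwd Q g j x * Q j x u \<le> (\<Sum>z\<in>UNIV. fwd Q g j z * Q j z u)"
    using Suc.prems by (intro member_le_sum mult_nonneg_nonneg Q fwd_nonneg[OF adm]) auto
  then have "0 < fwd Q g (Suc j) u"
    using xu g by (auto intro: less_le_trans mult_right_mono)
  then show ?case
    using fwd_nonneg[OF adm Suc.prems] by (intro sum_pos2[of _ u]) auto
qed

text \<open>These sums are the denominators of the backward smoothing kernel. Strictly positive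
  transitions keep them positive even at states \<open>u\<close> whose likelihood at time
  \<open>j + 1\<close> vanishes.\<close>

lemma pred_pos:
  fixes Q :: "nat \<Rightarrow> 'k::finite \<Rightarrow> 'k \<Rightarrow> real"
  assumes adm: "admissible Q g n" and "1 \<le> j" "j \<le> n"
  shows "0 < (\<Sum>z\<in>UNIV. fwd Q g j z * Q j z u)"
proof -
  obtain z where z: "0 < fwd Q g j z"
    using fwd_sum_pos[OF adm assms(3)] fwd_nonneg[OF adm assms(3)]
    by (metis less_eq_real_def less_irrefl sum.neutral)
  have Q: "0 < Q j z u" for z using adm assms(2) unfolding admissible_def by auto
  show ?thesis
    using z Q fwd_nonneg[OF adm assms(3)] by (intro sum_pos2[of _ z]) (auto simp: less_imp_le)
qed

lemma bwd_pos:
  fixes Q :: "nat \<Rightarrow> 'k::finite \<Rightarrow> 'k \<Rightarrow> real"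
  assumes adm: "admissible Q g n" and "1 \<le> j" "j \<le> n"
  shows "0 < bwd Q g n j x"
  using assms(3,2)
proof (induction j arbitrary: x rule: inc_induct)
  case base
  then show ?case by simp
next
  case (step j)
  have g: "0 \<le> g (Suc j) u" for u using adm step unfolding admissible_def by auto
  obtain u where u: "0 < g (Suc j) u" using adm step unfolding admissible_def by fastforce
  have Q: "0 < Q j x u" for u using adm step unfolding admissible_def by auto
  have b: "0 < bwd Q g n (Suc j) u" for u using step by auto
  show ?case unfolding bwd_step[OF step.hyps(2)]
    using u g Q b by (intro sum_pos2[of _ u]) (auto simp: less_imp_le)
qed

lemma weight_pos:
  fixes Q :: "nat \<Rightarrow> 'k::finite \<Rightarrow> 'k \<Rightarrow> real"
  assumes adm: "admissible Q g n" and "1 \<le> j" "j \<le> n"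
  shows "0 < (\<Sum>z\<in>UNIV. fwd Q g j z * bwd Q g n j z)"
proof -
  obtain z where z: "0 < fwd Q g j z"
    using fwd_sum_pos[OF adm assms(3)] fwd_nonneg[OF adm assms(3)]
    by (metis less_eq_real_def less_irrefl sum.neutral)
  show ?thesis
    using z bwd_pos[OF assms] fwd_nonneg[OF adm assms(3)]
    by (intro sum_pos2[of _ z]) (auto simp: less_imp_le)
qed

lemma post_sum:
  fixes Q :: "nat \<Rightarrow> 'k::finite \<Rightarrow> 'k \<Rightarrow> real"
  assumes "admissible Q g n" "1 \<le> j" "j \<le> n"
  shows "sum (post Q g n j) UNIV = 1"
  using weight_pos[OF assms] by (simp add: post_def sum_divide_distrib[symmetric])

section \<open>Markov structure of the smoothing laws\<close>

text \<open>The common value is the total mass of the product density over all paths. Hence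
  \<open>post\<close> has the same normalizing constant at all times.\<close>

lemma weight_step:
  fixes Q :: "nat \<Rightarrow> 'k::finite \<Rightarrow> 'k \<Rightarrow> real"
  assumes "j < n"
  shows "(\<Sum>z\<in>UNIV. fwd Q g (Suc j) z * bwd Q g n (Suc j) z) = (\<Sum>z\<in>UNIV. fwd Q g j z * bwd Q g n j z)"
proof -
  have "(\<Sum>z\<in>UNIV. fwd Q g j z * bwd Q g n j z)
      = (\<Sum>z\<in>UNIV. \<Sum>u\<in>UNIV. fwd Q g j z * Q j z u * (g (Suc j) u * bwd Q g n (Suc j) u))"
    by (simp add: bwd_step[OF assms] sum_distrib_left mult.assoc)
  also have "\<dots> = (\<Sum>u\<in>UNIV. fwd Q g (Suc j) u * bwd Q g n (Suc j) u)"
    by (subst sum.swap) (simp add: sum_distrib_right mult.assoc)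
  finally show ?thesis by simp
qed

text \<open>Given all observations, the hidden chain is still Markov; its kernel is the Doob
  transform of \<open>Q k\<close> by the backward weights. It reads only transitions from time
  \<open>k\<close> on and likelihoods after time \<open>k\<close>.\<close>

lemma post_forward:
  fixes Q :: "nat \<Rightarrow> 'k::finite \<Rightarrow> 'k \<Rightarrow> real"
  assumes adm: "admissible Q g n" and k: "1 \<le> k" "k < n"
  shows "post Q g n (Suc k) u =
    (\<Sum>x\<in>UNIV. post Q g n k x * (Q k x u * (g (Suc k) u * bwd Q g n (Suc k) u) / bwd Q g n k x))"
proof -
  define Z where "Z = (\<Sum>z\<in>UNIV. fwd Q g k z * bwd Q g n k z)"
  define h where "h = g (Suc k) u * bwd Q g n (Suc k) u"
  have b: "bwd Q g n k x \<noteq> 0" for x using bwd_pos[OF adm, of k x] k by simp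
  have "post Q g n (Suc k) u = (\<Sum>x\<in>UNIV. fwd Q g k x * Q k x u) * h / Z"
    unfolding post_def weight_step[OF k(2)] Z_def h_def by (simp add: mult.assoc)
  also have "\<dots> = (\<Sum>x\<in>UNIV. post Q g n k x * (Q k x u * h / bwd Q g n k x))"
    unfolding sum_distrib_right sum_divide_distrib post_def Z_def[symmetric]
    using b by (intro sum.cong) auto
  finally show ?thesis unfolding h_def .
qed

text \<open>In the time-reversed kernel the likelihood and the backward weight at time
  \<open>k + 1\<close> have cancelled, so it reads only transitions and likelihoods up to time
  \<open>k\<close>.\<close>

lemma post_backward:
  fixes Q :: "nat \<Rightarrow> 'k::finite \<Rightarrow> 'k \<Rightarrow> real"
  assumes adm: "admissible Q g n" and k: "1 \<le> k" "k < n"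
  shows "post Q g n k x =
    (\<Sum>u\<in>UNIV. post Q g n (Suc k) u * (fwd Q g k x * Q k x u / (\<Sum>z\<in>UNIV. fwd Q g k z * Q k z u)))"
proof -
  define Z where "Z = (\<Sum>z\<in>UNIV. fwd Q g k z * bwd Q g n k z)"
  define s where "s u = (\<Sum>z\<in>UNIV. fwd Q g k z * Q k z u)" for u
  have s: "s u \<noteq> 0" for u unfolding s_def using pred_pos[OF adm, of k u] k by simp
  have post: "post Q g n (Suc k) u = s u * g (Suc k) u * bwd Q g n (Suc k) u / Z" for u
    unfolding post_def weight_step[OF k(2)] Z_def s_def by simp
  have "post Q g n k x
      = (\<Sum>u\<in>UNIV. fwd Q g k x * (Q k x u * (g (Suc k) u * bwd Q g n (Suc k) u)) / Z)"
    unfolding post_def bwd_step[OF k(2), of _ _ x] Z_def by (simp add: sum_distrib_left sum_divide_distrib)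
  also have "\<dots> = (\<Sum>u\<in>UNIV. post Q g n (Suc k) u * (fwd Q g k x * Q k x u / s u))"
    unfolding post using s by (intro sum.cong) auto
  finally show ?thesis unfolding s_def .
qed

section \<open>Contraction along the smoothing kernels\<close>

text \<open>Agreement from time \<open>k\<close> on makes the forward kernel common to both models.
  Its numerator is at least \<open>d * h u\<close> and its denominator at most
  \<open>(1 - d) * H\<close>, so every row dominates \<open>d / (1 - d)\<close> times the law
  \<open>h u / H\<close>, whatever the starting state.\<close>

lemma contraction_forward_step:
  fixes Q :: "nat \<Rightarrow> 'k::finite \<Rightarrow> 'k \<Rightarrow> real"
  assumes adm: "admissible Q g n" "admissible Q' g' n" and k: "1 \<le> k" "k < n"
    and Q: "\<And>i. k \<le> i \<Longrightarrow> Q' i = Q i" and g: "\<And>i. k < i \<Longrightarrow> g' i = g i"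
    and d: "0 < d" "\<And>x u. d \<le> Q k x u" "\<And>x u. Q k x u \<le> 1 - d"
  shows "tv_dist (post Q g n (Suc k)) (post Q' g' n (Suc k))
    \<le> (1 - d / (1 - d)) * tv_dist (post Q g n k) (post Q' g' n k)"
proof -
  define h where "h u = g (Suc k) u * bwd Q g n (Suc k) u" for u
  define b where "b = bwd Q g n k"
  have bwd': "bwd Q' g' n k = b" "bwd Q' g' n (Suc k) = bwd Q g n (Suc k)"
    unfolding b_def using k by (auto intro!: bwd_cong Q g)
  have b: "b x = (\<Sum>u\<in>UNIV. Q k x u * h u)" for x
    unfolding b_def h_def using k by (simp add: bwd_step)
  have b0: "0 < b x" for x unfolding b_def using bwd_pos[OF adm(1)] k by auto
  have g0: "0 \<le> g (Suc k) u" for u using adm(1) k unfolding admissible_def by auto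
  have h0: "0 \<le> h u" for u unfolding h_def
    using bwd_pos[OF adm(1), of "Suc k" u] k g0 by (auto intro!: mult_nonneg_nonneg)
  define H where "H = sum h UNIV"
  have d1: "0 < 1 - d" using d by (metis less_le_trans order.strict_trans1)
  have bH: "b x \<le> (1 - d) * H" for x
    unfolding b H_def sum_distrib_left using d h0 by (intro sum_mono mult_right_mono) auto
  have H0: "0 < H" using b0 bH d1 by (metis less_le_trans zero_less_mult_pos)
  let ?P = "\<lambda>x u. Q k x u * h u / b x"
  have "tv_dist (\<lambda>u. \<Sum>x\<in>UNIV. post Q g n k x * ?P x u) (\<lambda>u. \<Sum>x\<in>UNIV. post Q' g' n k x * ?P x u)
      \<le> (1 - d / (1 - d)) * tv_dist (post Q g n k) (post Q' g' n k)"
  proof (rule tv_dist_contraction[where \<nu> = "\<lambda>u. h u / H"])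
    fix x u
    have "d / (1 - d) * (h u / H) = d * h u / ((1 - d) * H)" by simp
    also have "\<dots> \<le> d * h u / b x"
      using bH b0 d h0 d1 H0 by (intro divide_left_mono mult_nonneg_nonneg mult_pos_pos) auto
    also have "\<dots> \<le> Q k x u * h u / b x"
      using b0 h0 d by (intro divide_right_mono mult_right_mono) (auto simp: less_imp_le)
    finally show "d / (1 - d) * (h u / H) \<le> Q k x u * h u / b x" .
  next
    fix x show "(\<Sum>u\<in>UNIV. Q k x u * h u / b x) = 1"
      using b0[of x] by (simp add: sum_divide_distrib[symmetric] b[symmetric])
  next
    show "(\<Sum>u\<in>UNIV. h u / H) = 1"
      using H0 by (simp add: sum_divide_distrib[symmetric] H_def)
  next
    show "sum (post Q g n k) UNIV = sum (post Q' g' n k) UNIV"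
      using k by (simp add: post_sum adm)
  qed
  moreover have "post Q g n (Suc k) = (\<lambda>u. \<Sum>x\<in>UNIV. post Q g n k x * ?P x u)"
    using post_forward[OF adm(1) k] unfolding h_def b_def by (intro ext) auto
  moreover have "post Q' g' n (Suc k) = (\<lambda>u. \<Sum>x\<in>UNIV. post Q' g' n k x * ?P x u)"
    using post_forward[OF adm(2) k] unfolding h_def bwd' by (intro ext) (auto simp: Q g)
  ultimately show ?thesis by simp
qed

text \<open>A common past gives a common reversed kernel. The minorizing law is now the normalized
  forward weight \<open>a x / A\<close>, since the denominator \<open>s u\<close> is at most
  \<open>(1 - d) * A\<close> for every \<open>u\<close>.\<close>

lemma contraction_backward_step:
  fixes Q :: "nat \<Rightarrow> 'k::finite \<Rightarrow> 'k \<Rightarrow> real"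
  assumes adm: "admissible Q g n" "admissible Q' g' n" and k: "1 \<le> k" "k < n"
    and Q: "\<And>i. i \<le> k \<Longrightarrow> Q' i = Q i" and g: "\<And>i. i \<le> k \<Longrightarrow> g' i = g i"
    and d: "0 < d" "\<And>x u. d \<le> Q k x u" "\<And>x u. Q k x u \<le> 1 - d"
  shows "tv_dist (post Q g n k) (post Q' g' n k)
    \<le> (1 - d / (1 - d)) * tv_dist (post Q g n (Suc k)) (post Q' g' n (Suc k))"
proof -
  define a where "a = fwd Q g k"
  have fwd': "fwd Q' g' k = a" unfolding a_def by (auto intro!: fwd_cong Q g)
  define s where "s u = (\<Sum>z\<in>UNIV. a z * Q k z u)" for u
  have s0: "0 < s u" for u unfolding s_def a_def using pred_pos[OF adm(1)] k by auto
  have a0: "0 \<le> a u" for u unfolding a_def using fwd_nonneg[OF adm(1)] k by auto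
  define A where "A = sum a UNIV"
  have A0: "0 < A" unfolding A_def a_def using fwd_sum_pos[OF adm(1), of k] k by simp
  have d1: "0 < 1 - d" using d by (metis less_le_trans order.strict_trans1)
  have sA: "s u \<le> (1 - d) * A" for u
    unfolding s_def A_def sum_distrib_left using d a0
    by (intro sum_mono) (simp add: mult.commute mult_left_mono)
  let ?P = "\<lambda>u x. a x * Q k x u / s u"
  have "tv_dist (\<lambda>x. \<Sum>u\<in>UNIV. post Q g n (Suc k) u * ?P u x)
          (\<lambda>x. \<Sum>u\<in>UNIV. post Q' g' n (Suc k) u * ?P u x)
      \<le> (1 - d / (1 - d)) * tv_dist (post Q g n (Suc k)) (post Q' g' n (Suc k))"
  proof (rule tv_dist_contraction[where \<nu> = "\<lambda>x. a x / A"])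
    fix u x
    have "d / (1 - d) * (a x / A) = a x * d / ((1 - d) * A)" by simp
    also have "\<dots> \<le> a x * d / s u"
      using sA s0 d a0 d1 A0 by (intro divide_left_mono mult_nonneg_nonneg mult_pos_pos) auto
    also have "\<dots> \<le> a x * Q k x u / s u"
      using s0 a0 d by (intro divide_right_mono mult_left_mono) (auto simp: less_imp_le)
    finally show "d / (1 - d) * (a x / A) \<le> a x * Q k x u / s u" .
  next
    fix u show "(\<Sum>x\<in>UNIV. a x * Q k x u / s u) = 1"
      using s0[of u] by (simp add: sum_divide_distrib[symmetric] s_def)
  next
    show "(\<Sum>x\<in>UNIV. a x / A) = 1"
      using A0 by (simp add: sum_divide_distrib[symmetric] A_def)
  next
    show "sum (post Q g n (Suc k)) UNIV = sum (post Q' g' n (Suc k)) UNIV"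
      using k by (simp add: post_sum adm)
  qed
  moreover have "post Q g n k = (\<lambda>x. \<Sum>u\<in>UNIV. post Q g n (Suc k) u * ?P u x)"
    using post_backward[OF adm(1) k] unfolding a_def s_def by (intro ext) auto
  moreover have "post Q' g' n k = (\<lambda>x. \<Sum>u\<in>UNIV. post Q' g' n (Suc k) u * ?P u x)"
    using post_backward[OF adm(2) k] unfolding fwd' s_def by (intro ext) (auto simp: Q)
  ultimately show ?thesis by simp
qed

lemma contraction_forward:
  fixes Q :: "nat \<Rightarrow> 'k::finite \<Rightarrow> 'k \<Rightarrow> real"
  assumes adm: "admissible Q g n" "admissible Q' g' n" and jk: "1 \<le> j" "j \<le> k" "k \<le> n"
    and Q: "\<And>i. j \<le> i \<Longrightarrow> Q' i = Q i" and g: "\<And>i. j < i \<Longrightarrow> g' i = g i"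
    and d: "0 < d" "d \<le> 1/2" "\<And>i x u. j \<le> i \<Longrightarrow> d \<le> Q i x u" "\<And>i x u. j \<le> i \<Longrightarrow> Q i x u \<le> 1 - d"
  shows "tv_dist (post Q g n k) (post Q' g' n k)
    \<le> (1 - d / (1 - d)) ^ (k - j) * tv_dist (post Q g n j) (post Q' g' n j)"
  using jk(2,3)
proof (induction k rule: dec_induct)
  case base
  then show ?case by simp
next
  case (step k)
  have r: "0 \<le> 1 - d / (1 - d)" using d(1,2) by (simp add: field_simps)
  have "tv_dist (post Q g n (Suc k)) (post Q' g' n (Suc k))
      \<le> (1 - d / (1 - d)) * tv_dist (post Q g n k) (post Q' g' n k)"
    using step jk by (intro contraction_forward_step adm Q g d) auto
  also have "\<dots> \<le> (1 - d / (1 - d)) * ((1 - d / (1 - d)) ^ (k - j) * tv_dist (post Q g n j) (post Q' g' n j))"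
    using step r by (intro mult_left_mono) auto
  finally show ?case using step by (simp add: Suc_diff_le mult.assoc)
qed

lemma contraction_backward:
  fixes Q :: "nat \<Rightarrow> 'k::finite \<Rightarrow> 'k \<Rightarrow> real"
  assumes adm: "admissible Q g n" "admissible Q' g' n" and kj: "1 \<le> k" "k \<le> j" "j \<le> n"
    and Q: "\<And>i. i < j \<Longrightarrow> Q' i = Q i" and g: "\<And>i. i < j \<Longrightarrow> g' i = g i"
    and d: "0 < d" "d \<le> 1/2" "\<And>i x u. 1 \<le> i \<Longrightarrow> i < j \<Longrightarrow> d \<le> Q i x u"
      "\<And>i x u. 1 \<le> i \<Longrightarrow> i < j \<Longrightarrow> Q i x u \<le> 1 - d"
  shows "tv_dist (post Q g n k) (post Q' g' n k)
    \<le> (1 - d / (1 - d)) ^ (j - k) * tv_dist (post Q g n j) (post Q' g' n j)"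
  using kj(2,1)
proof (induction k rule: inc_induct)
  case base
  then show ?case by simp
next
  case (step k)
  have r: "0 \<le> 1 - d / (1 - d)" using d(1,2) by (simp add: field_simps)
  have "tv_dist (post Q g n k) (post Q' g' n k)
      \<le> (1 - d / (1 - d)) * tv_dist (post Q g n (Suc k)) (post Q' g' n (Suc k))"
    using step kj by (intro contraction_backward_step adm Q g d) auto
  also have "\<dots> \<le> (1 - d / (1 - d)) * ((1 - d / (1 - d)) ^ (j - Suc k) * tv_dist (post Q g n j) (post Q' g' n j))"
    using step r by (intro mult_left_mono) auto
  also have "\<dots> = (1 - d / (1 - d)) ^ (j - k) * tv_dist (post Q g n j) (post Q' g' n j)"
    using step by (simp add: Suc_diff_Suc[symmetric] mult.assoc)
  finally show ?case .
qed

section \<open>Local effect of replacing one factor\<close>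

text \<open>One transition mixes the states: both values lie between \<open>d\<close> and
  \<open>1 - d\<close> times the same sum of \<open>h\<close>. At the horizon both are 1, and
  \<open>d \<le> 1/2\<close> gives the claim.\<close>

lemma bwd_ratio:
  fixes Q :: "nat \<Rightarrow> 'k::finite \<Rightarrow> 'k \<Rightarrow> real"
  assumes adm: "admissible Q g n" and j: "1 \<le> j" "j \<le> n"
    and d: "0 < d" "d \<le> 1/2" "\<And>x u. d \<le> Q j x u" "\<And>x u. Q j x u \<le> 1 - d"
  shows "bwd Q g n j x \<le> (1 - d) / d * bwd Q g n j z"
proof (cases "j = n")
  case True
  then show ?thesis using d by (simp add: field_simps)
next
  case False
  define h where "h u = g (Suc j) u * bwd Q g n (Suc j) u" for u
  have jn: "j < n" using False j by simp
  have g: "0 \<le> g (Suc j) u" for u using adm jn unfolding admissible_def by auto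
  have h0: "0 \<le> h u" for u unfolding h_def
    using bwd_pos[OF adm, of "Suc j" u] jn g by (auto intro!: mult_nonneg_nonneg)
  have "bwd Q g n j x \<le> (1 - d) * sum h UNIV"
    unfolding bwd_step[OF jn] h_def[symmetric] sum_distrib_left using d h0
    by (intro sum_mono mult_right_mono) auto
  moreover have "d * sum h UNIV \<le> bwd Q g n j z"
    unfolding bwd_step[OF jn] h_def[symmetric] sum_distrib_left using d h0
    by (intro sum_mono mult_right_mono) auto
  then have "(1 - d) / d * (d * sum h UNIV) \<le> (1 - d) / d * bwd Q g n j z"
    using d by (intro mult_left_mono) auto
  ultimately show ?thesis using d by simp
qed

text \<open>At the time of the replaced likelihood the weight is
  \<open>s u * g (Suc l) u * b u\<close>, with the prediction \<open>s\<close> and the backward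
  weight \<open>b\<close> untouched. The change is at most \<open>D\<close> times the mass of
  \<open>s\<close> times the maximum of \<open>b\<close>; the total is at least \<open>c\<close>
  times the mass of \<open>s\<close> times the minimum of \<open>b\<close>.\<close>

lemma likelihood_change_local:
  fixes Q :: "nat \<Rightarrow> 'k::finite \<Rightarrow> 'k \<Rightarrow> real"
  assumes adm: "admissible Q g n" "admissible Q g' n" and l: "l < n"
    and g: "\<And>i. i \<noteq> Suc l \<Longrightarrow> g' i = g i"
    and Q: "\<And>x. (\<Sum>u\<in>UNIV. Q l x u) = 1"
    and c: "0 < c" "\<And>x. c \<le> (\<Sum>u\<in>UNIV. Q l x u * g (Suc l) u)"
    and D: "\<And>u. \<bar>g (Suc l) u - g' (Suc l) u\<bar> \<le> D"
    and r: "\<And>x z. bwd Q g n (Suc l) x \<le> r * bwd Q g n (Suc l) z"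
  shows "tv_dist (post Q g n (Suc l)) (post Q g' n (Suc l)) \<le> 2 * r * D / c"
proof -
  define a where "a = fwd Q g l"
  define b where "b = bwd Q g n (Suc l)"
  define s where "s u = (\<Sum>z\<in>UNIV. a z * Q l z u)" for u
  have a': "fwd Q g' l = a" unfolding a_def by (intro fwd_cong g) auto
  have b': "bwd Q g' n (Suc l) = b" unfolding b_def using l by (intro bwd_cong g) auto
  have a0: "0 \<le> a x" for x unfolding a_def using fwd_nonneg[OF adm(1)] l by auto
  have Q0: "0 \<le> Q l x u" for x u
    using adm(1) unfolding admissible_def by (cases l) (auto intro: less_imp_le)
  have g0: "0 \<le> g (Suc l) u" for u using adm(1) l unfolding admissible_def by auto
  have b0: "0 < b x" for x unfolding b_def using bwd_pos[OF adm(1)] l by auto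
  have s0: "0 \<le> s u" for u unfolding s_def using a0 Q0 by (auto intro!: sum_nonneg)
  define A where "A = sum a UNIV"
  have A0: "0 < A" unfolding A_def a_def using fwd_sum_pos[OF adm(1), of l] l by simp
  have sA: "sum s UNIV = A"
    unfolding s_def A_def by (subst sum.swap) (simp add: sum_distrib_left[symmetric] Q)
  \<comment> \<open>The prediction \<open>s\<close> mixes the rows of \<open>Q l\<close> with
    weights \<open>a\<close>, so it inherits the bound \<open>c\<close> that holds for each
    row.\<close>
  have cA: "c * A \<le> (\<Sum>u\<in>UNIV. s u * g (Suc l) u)"
  proof -
    have "c * A = (\<Sum>x\<in>UNIV. a x * c)" by (simp add: A_def sum_distrib_left mult.commute)
    also have "\<dots> \<le> (\<Sum>x\<in>UNIV. a x * (\<Sum>u\<in>UNIV. Q l x u * g (Suc l) u))"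
      using a0 c by (intro sum_mono mult_left_mono)
    also have "\<dots> = (\<Sum>u\<in>UNIV. s u * g (Suc l) u)"
      unfolding s_def sum_distrib_left sum_distrib_right by (subst sum.swap) (simp add: mult.assoc)
    finally show ?thesis .
  qed
  \<comment> \<open>The scale of \<open>b\<close> is unknown and has to cancel: \<open>m\<close>
    bounds the total from below, \<open>r * m\<close> bounds the change from above.\<close>
  define m where "m = Min (range b)"
  have m: "m \<le> b x" for x unfolding m_def by simp
  have "m \<in> range b" unfolding m_def by (intro Min_in) auto
  then obtain z where z: "m = b z" by auto
  have m0: "0 < m" using b0 z by simp
  have bm: "b x \<le> r * m" for x unfolding z b_def by (rule r)
  have rm: "0 \<le> r * m" using bm[of undefined] b0[of undefined] by linarith
  have D0: "0 \<le> D" using D[of undefined] by linarith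
  define w where "w = (\<lambda>u. fwd Q g (Suc l) u * b u)"
  define w' where "w' = (\<lambda>u. fwd Q g' (Suc l) u * b u)"
  have "c * A * m \<le> (\<Sum>u\<in>UNIV. s u * g (Suc l) u) * m"
    using cA m0 by (intro mult_right_mono) auto
  also have "\<dots> \<le> sum w UNIV"
    unfolding w_def sum_distrib_right using s0 g0 m
    by (intro sum_mono) (auto simp: s_def a_def intro!: mult_left_mono)
  finally have W: "c * A * m \<le> sum w UNIV" .
  have cAm: "0 < c * A * m" using c A0 m0 by simp
  have "tv_dist w w' = (\<Sum>u\<in>UNIV. s u * \<bar>g (Suc l) u - g' (Suc l) u\<bar> * b u)"
  proof -
    have "w u - w' u = s u * (g (Suc l) u - g' (Suc l) u) * b u" for u
      unfolding w_def w'_def by (simp add: a' a_def[symmetric] s_def[symmetric] algebra_simps)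
    then show ?thesis
      unfolding tv_dist_def using s0 b0 by (simp add: abs_mult less_imp_le abs_of_nonneg)
  qed
  also have "\<dots> \<le> (\<Sum>u\<in>UNIV. s u * D * (r * m))"
    using s0 D D0 bm b0 by (intro sum_mono mult_mono mult_left_mono) (auto simp: less_imp_le)
  also have "\<dots> = A * D * (r * m)" by (simp add: sum_distrib_right[symmetric] sA)
  finally have ww: "tv_dist w w' \<le> A * D * (r * m)" .
  have "tv_dist (post Q g n (Suc l)) (post Q g' n (Suc l))
      = tv_dist (\<lambda>x. w x / sum w UNIV) (\<lambda>x. w' x / sum w' UNIV)"
    by (intro arg_cong2[of _ _ _ _ tv_dist] ext) (simp_all only: post_def w_def w'_def b' b_def)
  also have "\<dots> \<le> 2 * tv_dist w w' / sum w UNIV"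
  proof (rule tv_dist_normalize)
    show "0 \<le> w' x" for x unfolding w'_def
      using fwd_nonneg[OF adm(2), of "Suc l"] b0 l by (intro mult_nonneg_nonneg) (auto simp: less_imp_le simp del: fwd.simps)
    show "0 < sum w UNIV" using W cAm by simp
    show "0 < sum w' UNIV"
      unfolding w'_def b'[symmetric] using weight_pos[OF adm(2), of "Suc l"] l by simp
  qed
  also have "\<dots> \<le> 2 * (A * D * (r * m)) / (c * A * m)"
    using ww W cAm A0 D0 rm by (intro frac_le) auto
  also have "\<dots> = 2 * r * D / c" using A0 m0 by simp
  finally show ?thesis .
qed

text \<open>The joint law of the states at times \<open>j\<close> and \<open>j + 1\<close> has
  density \<open>a x * Q j x u * h u\<close>. Its change and its mass are compared with the same
  product \<open>A * H\<close>, which cancels. Both marginals inherit the bound: the one at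
  \<open>j + 1\<close> starts a forward contraction, the one at \<open>j\<close> a backward
  contraction.\<close>

lemma transition_change_local:
  fixes Q :: "nat \<Rightarrow> 'k::finite \<Rightarrow> 'k \<Rightarrow> real"
  assumes adm: "admissible Q g n" "admissible Q' g n" and j: "j < n"
    and Q: "\<And>i. i \<noteq> j \<Longrightarrow> Q' i = Q i"
    and d: "0 < d" "\<And>x u. d \<le> Q j x u" and \<eta>: "\<And>x u. \<bar>Q j x u - Q' j x u\<bar> \<le> \<eta>"
  shows "tv_dist (post Q g n (Suc j)) (post Q' g n (Suc j)) \<le> 2 * \<eta> / d"
    and "1 \<le> j \<Longrightarrow> tv_dist (post Q g n j) (post Q' g n j) \<le> 2 * \<eta> / d"
proof -
  define a where "a = fwd Q g j"
  define b where "b = bwd Q g n (Suc j)"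
  define h where "h u = g (Suc j) u * b u" for u
  have a': "fwd Q' g j = a" unfolding a_def by (intro fwd_cong Q) auto
  have b': "bwd Q' g n (Suc j) = b" unfolding b_def using j by (intro bwd_cong Q) auto
  have a0: "0 \<le> a x" for x unfolding a_def using fwd_nonneg[OF adm(1)] j by auto
  have b0: "0 < b x" for x unfolding b_def using bwd_pos[OF adm(1)] j by auto
  have g0: "0 \<le> g (Suc j) u" for u using adm(1) j unfolding admissible_def by auto
  have h0: "0 \<le> h u" for u unfolding h_def using g0 b0 by (simp add: less_imp_le)
  define A H where "A = sum a UNIV" and "H = sum h UNIV"
  have A0: "0 < A" unfolding A_def a_def using fwd_sum_pos[OF adm(1), of j] j by simp
  obtain u where "0 < g (Suc j) u" using adm(1) j unfolding admissible_def by fastforce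
  then have H0: "0 < H"
    unfolding H_def using h0 b0 by (intro sum_pos2[of _ u]) (auto simp: h_def)
  have AH: "(\<Sum>x\<in>UNIV. \<Sum>u\<in>UNIV. a x * t * h u) = t * (A * H)" for t
    unfolding A_def H_def sum_product by (simp add: sum_distrib_left mult_ac)
  have \<eta>0: "0 \<le> \<eta>" using \<eta>[of undefined undefined] by linarith
  let ?J = "\<lambda>x u. a x * Q j x u * h u" and ?J' = "\<lambda>x u. a x * Q' j x u * h u"
  have mass: "d * (A * H) \<le> (\<Sum>x\<in>UNIV. \<Sum>u\<in>UNIV. ?J x u)"
    unfolding AH[symmetric] using a0 h0 d by (intro sum_mono mult_right_mono mult_left_mono)
  have "(\<Sum>x\<in>UNIV. \<Sum>u\<in>UNIV. \<bar>?J x u - ?J' x u\<bar>) \<le> (\<Sum>x\<in>UNIV. \<Sum>u\<in>UNIV. a x * \<eta> * h u)"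
  proof (intro sum_mono)
    fix x u
    have "?J x u - ?J' x u = a x * (Q j x u - Q' j x u) * h u" by (simp add: algebra_simps)
    then have "\<bar>?J x u - ?J' x u\<bar> = a x * \<bar>Q j x u - Q' j x u\<bar> * h u"
      using a0 h0 by (simp add: abs_mult)
    then show "\<bar>?J x u - ?J' x u\<bar> \<le> a x * \<eta> * h u"
      using a0 h0 \<eta> by (auto intro!: mult_right_mono mult_left_mono)
  qed
  then have diff: "(\<Sum>x\<in>UNIV. \<Sum>u\<in>UNIV. \<bar>?J x u - ?J' x u\<bar>) \<le> \<eta> * (A * H)" unfolding AH .
  have dAH: "0 < d * (A * H)" using d A0 H0 by simp
  \<comment> \<open>Here \<open>w\<close> and \<open>w'\<close> stand for the same marginal of the
    two joint densities: the total mass is preserved and the distance does not increase.\<close>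
  have bound: "tv_dist (\<lambda>x. w x / sum w UNIV) (\<lambda>x. w' x / sum w' UNIV) \<le> 2 * \<eta> / d"
    if "\<And>x. 0 \<le> w' x" "0 < sum w UNIV" "0 < sum w' UNIV"
      and W: "sum w UNIV = (\<Sum>x\<in>UNIV. \<Sum>u\<in>UNIV. ?J x u)"
      and ww: "tv_dist w w' \<le> (\<Sum>x\<in>UNIV. \<Sum>u\<in>UNIV. \<bar>?J x u - ?J' x u\<bar>)"
    for w w' :: "'k \<Rightarrow> real"
  proof -
    have "tv_dist (\<lambda>x. w x / sum w UNIV) (\<lambda>x. w' x / sum w' UNIV) \<le> 2 * tv_dist w w' / sum w UNIV"
      using that by (intro tv_dist_normalize)
    also have "\<dots> \<le> 2 * (\<eta> * (A * H)) / (d * (A * H))"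
      using ww diff mass W dAH A0 H0 \<eta>0 by (intro frac_le) auto
    also have "\<dots> = 2 * \<eta> / d" using A0 H0 by simp
    finally show ?thesis .
  qed
  have fwd_split: "fwd Q g (Suc j) u * b u = (\<Sum>x\<in>UNIV. ?J x u)"
    "fwd Q' g (Suc j) u * b u = (\<Sum>x\<in>UNIV. ?J' x u)" for u
    by (simp_all add: a' a_def[symmetric] h_def mult.assoc[symmetric] sum_distrib_right)
  have bwd_split: "a x * bwd Q g n j x = (\<Sum>u\<in>UNIV. ?J x u)"
    "a x * bwd Q' g n j x = (\<Sum>u\<in>UNIV. ?J' x u)" for x
    by (simp_all add: bwd_step[OF j] b' b_def[symmetric] h_def sum_distrib_left mult_ac)
  define w where "w = (\<lambda>u. fwd Q g (Suc j) u * b u)"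
  define w' where "w' = (\<lambda>u. fwd Q' g (Suc j) u * b u)"
  have "tv_dist (post Q g n (Suc j)) (post Q' g n (Suc j))
      = tv_dist (\<lambda>x. w x / sum w UNIV) (\<lambda>x. w' x / sum w' UNIV)"
    by (intro arg_cong2[of _ _ _ _ tv_dist] ext) (simp_all only: post_def w_def w'_def b' b_def)
  also have "\<dots> \<le> 2 * \<eta> / d"
  proof (rule bound)
    show "0 \<le> w' x" for x unfolding w'_def
      using fwd_nonneg[OF adm(2), of "Suc j"] b0 j
      by (intro mult_nonneg_nonneg) (auto simp: less_imp_le simp del: fwd.simps)
    show "0 < sum w UNIV"
      unfolding w_def b_def using weight_pos[OF adm(1), of "Suc j"] j by simp
    show "0 < sum w' UNIV"
      unfolding w'_def b'[symmetric] using weight_pos[OF adm(2), of "Suc j"] j by simp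
    show "sum w UNIV = (\<Sum>x\<in>UNIV. \<Sum>u\<in>UNIV. ?J x u)"
      unfolding w_def fwd_split by (rule sum.swap)
    have "tv_dist w w' \<le> (\<Sum>u\<in>UNIV. \<Sum>x\<in>UNIV. \<bar>?J x u - ?J' x u\<bar>)"
      unfolding tv_dist_def w_def w'_def fwd_split sum_subtractf[symmetric] by (intro sum_mono sum_abs)
    then show "tv_dist w w' \<le> (\<Sum>x\<in>UNIV. \<Sum>u\<in>UNIV. \<bar>?J x u - ?J' x u\<bar>)"
      by (subst sum.swap)
  qed
  finally show "tv_dist (post Q g n (Suc j)) (post Q' g n (Suc j)) \<le> 2 * \<eta> / d" .
  assume j1: "1 \<le> j"
  define v where "v = (\<lambda>x. a x * bwd Q g n j x)"
  define v' where "v' = (\<lambda>x. a x * bwd Q' g n j x)"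
  have "tv_dist (post Q g n j) (post Q' g n j)
      = tv_dist (\<lambda>x. v x / sum v UNIV) (\<lambda>x. v' x / sum v' UNIV)"
    by (intro arg_cong2[of _ _ _ _ tv_dist] ext) (simp_all only: post_def v_def v'_def a' a_def)
  also have "\<dots> \<le> 2 * \<eta> / d"
  proof (rule bound)
    show "0 \<le> v' x" for x unfolding v'_def
      using bwd_pos[OF adm(2) j1, of x] a0 j by (simp add: less_imp_le)
    show "0 < sum v UNIV"
      unfolding v_def a_def using weight_pos[OF adm(1), of j] j j1 by simp
    show "0 < sum v' UNIV"
      unfolding v'_def a'[symmetric] using weight_pos[OF adm(2), of j] j j1 by simp
    show "sum v UNIV = (\<Sum>x\<in>UNIV. \<Sum>u\<in>UNIV. ?J x u)"
      unfolding v_def bwd_split ..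
    show "tv_dist v v' \<le> (\<Sum>x\<in>UNIV. \<Sum>u\<in>UNIV. \<bar>?J x u - ?J' x u\<bar>)"
      unfolding tv_dist_def v_def v'_def bwd_split sum_subtractf[symmetric] by (intro sum_mono sum_abs)
  qed
  finally show "tv_dist (post Q g n j) (post Q' g n j) \<le> 2 * \<eta> / d" .
qed

section \<open>Propagation and summation of the local errors\<close>

text \<open>The forward kernels starting at time \<open>Suc l\<close> use later likelihoods only,
  and the backward kernels leading down from it use earlier ones only, so neither contains the
  replaced factor. All transitions are those of \<open>Q\<close>, whence one rate for both
  directions.\<close>

lemma likelihood_change:
  fixes Q :: "nat \<Rightarrow> 'k::finite \<Rightarrow> 'k \<Rightarrow> real"
  assumes adm: "admissible Q g n" "admissible Q g' n" and l: "l < n" and k: "1 \<le> k" "k \<le> n"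
    and g: "\<And>i. i \<noteq> Suc l \<Longrightarrow> g' i = g i"
    and Q: "\<And>x. (\<Sum>u\<in>UNIV. Q l x u) = 1"
    and c: "0 < c" "\<And>x. c \<le> (\<Sum>u\<in>UNIV. Q l x u * g (Suc l) u)"
    and D: "\<And>u. \<bar>g (Suc l) u - g' (Suc l) u\<bar> \<le> D"
    and d: "0 < d" "d \<le> 1/2" "\<And>i x u. 1 \<le> i \<Longrightarrow> d \<le> Q i x u" "\<And>i x u. 1 \<le> i \<Longrightarrow> Q i x u \<le> 1 - d"
  shows "tv_dist (post Q g n k) (post Q g' n k)
    \<le> (1 - d / (1 - d)) ^ nat \<bar>int (Suc l) - int k\<bar> * (2 * ((1 - d) / d) * D / c)"
proof -
  have r: "0 \<le> 1 - d / (1 - d)" using d(1,2) by (simp add: field_simps)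
  have "tv_dist (post Q g n k) (post Q g' n k) \<le> (1 - d / (1 - d)) ^ nat \<bar>int (Suc l) - int k\<bar>
      * tv_dist (post Q g n (Suc l)) (post Q g' n (Suc l))"
  proof (cases "Suc l \<le> k")
    case True
    then have dist: "nat \<bar>int (Suc l) - int k\<bar> = k - Suc l" by auto
    show ?thesis unfolding dist
      by (rule contraction_forward[OF adm _ True k(2)]) (use d g in auto)
  next
    case False
    then have dist: "nat \<bar>int (Suc l) - int k\<bar> = Suc l - k" by auto
    show ?thesis unfolding dist
      by (rule contraction_backward[OF adm k(1)]) (use False l d g in auto)
  qed
  also have "\<dots> \<le> (1 - d / (1 - d)) ^ nat \<bar>int (Suc l) - int k\<bar> * (2 * ((1 - d) / d) * D / c)"
    using r l d by (intro mult_left_mono likelihood_change_local[OF adm l g Q c D] bwd_ratio[OF adm(1)]) auto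
  finally show ?thesis .
qed

text \<open>
  The factors are replaced one at a time: first the likelihoods, while all transitions are those of
  \<open>Q\<close>, so that the constants depend on \<open>Q\<close> only; then the transitions from left to right, so that
  the past of the replaced one is governed by \<open>Q'\<close> and its future by \<open>Q\<close>.
\<close>

lemma post_perturbation:
  fixes Q Q' :: "nat \<Rightarrow> 'k::finite \<Rightarrow> 'k \<Rightarrow> real"
  assumes adm: "admissible Q g n" "admissible Q' g' n" and k: "1 \<le> k" "k \<le> n"
    and Q: "\<And>i x. (\<Sum>u\<in>UNIV. Q i x u) = 1"
    and c: "\<And>l. l \<in> {1..n} \<Longrightarrow> 0 < c l"
      "\<And>l x. l \<in> {1..n} \<Longrightarrow> c l \<le> (\<Sum>u\<in>UNIV. Q (l - 1) x u * g l u)"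
    and D: "\<And>l u. l \<in> {1..n} \<Longrightarrow> \<bar>g l u - g' l u\<bar> \<le> D l"
    and d: "0 < d" "d \<le> 1/2" "\<And>i x u. d \<le> Q i x u" "\<And>i x u. 1 \<le> i \<Longrightarrow> Q i x u \<le> 1 - d"
    and d': "0 < d'" "d' \<le> 1/2" "\<And>i x u. 1 \<le> i \<Longrightarrow> d' \<le> Q' i x u" "\<And>i x u. 1 \<le> i \<Longrightarrow> Q' i x u \<le> 1 - d'"
    and \<eta>0: "\<And>x u. \<bar>Q 0 x u - Q' 0 x u\<bar> \<le> \<eta>\<^sub>0"
    and \<eta>: "\<And>i x u. 1 \<le> i \<Longrightarrow> \<bar>Q i x u - Q' i x u\<bar> \<le> \<eta>"
  defines "r \<equiv> 1 - d / (1 - d)" and "r' \<equiv> 1 - d' / (1 - d')"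
  shows "tv_dist (post Q g n k) (post Q' g' n k)
    \<le> (\<Sum>l=1..n. r ^ nat \<bar>int l - int k\<bar> * (2 * ((1 - d) / d) * D l / c l))
      + (r ^ (k - 1) * (2 * \<eta>\<^sub>0 / d) + (1 / (1 - r) + 1 / (1 - r')) * (2 * \<eta> / d))"
proof -
  have n: "1 \<le> n" using k by simp
  have r: "0 \<le> r" "r < 1" using d(1,2) unfolding r_def by (simp_all add: field_simps)
  have r': "0 \<le> r'" "r' < 1" using d'(1,2) unfolding r'_def by (simp_all add: field_simps)
  have Qpos: "0 < Q i x u" for i x u using d(1,3) by (rule less_le_trans)
  \<comment> \<open>The lower bound \<open>d\<close> also holds for \<open>Q 0\<close>, so the true
    initial law is compatible with any likelihoods that are not identically zero, in particular with
    those of every hybrid.\<close>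
  have adm_Q: "admissible Q h n" if h: "\<And>i x. i \<in> {1..n} \<Longrightarrow> 0 \<le> h i x" "\<And>i. i \<in> {1..n} \<Longrightarrow> \<exists>x. 0 < h i x" for h
  proof -
    obtain u where "0 < h 1 u" using h(2)[of 1] n by auto
    then have "0 < Q 0 undefined u * h 1 u" using Qpos by simp
    then show ?thesis using h Qpos unfolding admissible_def by (fastforce intro: less_imp_le)
  qed
  define G where "G m i = (if i \<le> m then g' i else g i)" for m i
  have adm_G: "admissible Q (G m) n" for m
  proof (rule adm_Q)
    fix i x assume "i \<in> {1..n}"
    then show "0 \<le> G m i x" "\<exists>x. 0 < G m i x"
      using adm unfolding admissible_def G_def by auto
  qed
  have Gn: "post Q (G n) n k = post Q g' n k"
  proof -
    have "fwd Q (G n) k = fwd Q g' k" using k by (intro fwd_cong) (auto simp: G_def)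
    \<comment> \<open>\<open>G n\<close> agrees with \<open>g'\<close> only up to the horizon,
      whereas \<open>bwd_cong\<close> asks for agreement at all later times; hence a direct
      induction over the steps that stay below \<open>n\<close>.\<close>
    moreover have "bwd_steps Q (G n) m j = bwd_steps Q g' m j" if "j + m \<le> n" for m j
      using that by (induction m arbitrary: j) (auto simp: G_def)
    ultimately show ?thesis using k by (intro ext) (simp add: post_def bwd_def)
  qed
  have G0: "post Q (G 0) n k = post Q g n k"
  proof -
    have "fwd Q (G 0) k = fwd Q g k" by (intro fwd_cong) (auto simp: G_def)
    moreover have "bwd Q (G 0) n k = bwd Q g n k" using k by (intro bwd_cong) (auto simp: G_def)
    ultimately show ?thesis by (intro ext) (simp add: post_def)
  qed
  have "tv_dist (post Q g n k) (post Q g' n k)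
      \<le> (\<Sum>l<n. tv_dist (post Q (G l) n k) (post Q (G (Suc l)) n k))"
    using tv_dist_telescope[of "\<lambda>l. post Q (G l) n k" n] by (simp add: G0 Gn)
  also have "\<dots> \<le> (\<Sum>l<n. r ^ nat \<bar>int (Suc l) - int k\<bar> * (2 * ((1 - d) / d) * D (Suc l) / c (Suc l)))"
  proof (rule sum_mono)
    fix l assume "l \<in> {..<n}"
    then have l: "l < n" and l': "Suc l \<in> {1..n}" by auto
    show "tv_dist (post Q (G l) n k) (post Q (G (Suc l)) n k)
        \<le> r ^ nat \<bar>int (Suc l) - int k\<bar> * (2 * ((1 - d) / d) * D (Suc l) / c (Suc l))"
      unfolding r_def
    proof (rule likelihood_change[OF adm_G adm_G l k])
      show "0 < c (Suc l)" using c l' by blast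
      show "c (Suc l) \<le> (\<Sum>u\<in>UNIV. Q l x u * G l (Suc l) u)" for x
        using c(2)[OF l', of x] by (simp add: G_def)
      show "\<bar>G l (Suc l) u - G (Suc l) (Suc l) u\<bar> \<le> D (Suc l)" for u
        using D[OF l', of u] by (simp add: G_def)
    qed (use d in \<open>auto simp: G_def Q\<close>)
  qed
  also have "\<dots> = (\<Sum>l=1..n. r ^ nat \<bar>int l - int k\<bar> * (2 * ((1 - d) / d) * D l / c l))"
    unfolding lessThan_atLeast0
    by (subst sum.shift_bounds_Suc_ivl[symmetric]) (simp add: atLeastLessThanSuc_atLeastAtMost)
  finally have likelihoods: "tv_dist (post Q g n k) (post Q g' n k)
      \<le> (\<Sum>l=1..n. r ^ nat \<bar>int l - int k\<bar> * (2 * ((1 - d) / d) * D l / c l))" .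

  \<comment> \<open>The inequality is strict, unlike that in \<open>G\<close>: transitions are
    counted from 0 and likelihoods from 1. Thus \<open>M j\<close> and \<open>M (Suc j)\<close>
    differ at index \<open>j\<close> only.\<close>
  define M where "M m i = (if i < m then Q' i else Q i)" for m i
  \<comment> \<open>\<open>Q' 0\<close> is known to be compatible with \<open>g'\<close> only, not
    with \<open>g\<close>. This is a second reason to replace the likelihoods before the
    transitions.\<close>
  have adm_M: "admissible (M m) g' n" for m
    using adm(2) adm_Q[of g'] unfolding admissible_def M_def by (cases "m = 0") auto
  have M0: "M 0 = Q" by (intro ext) (simp add: M_def)
  have Mn: "post (M n) g' n k = post Q' g' n k"
  proof -
    have "fwd (M n) g' k = fwd Q' g' k" using k by (intro fwd_cong) (auto simp: M_def)
    moreover have "bwd_steps (M n) g' m j = bwd_steps Q' g' m j" if "j + m \<le> n" for m j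
      using that by (induction m arbitrary: j) (auto simp: M_def)
    ultimately show ?thesis using k by (intro ext) (simp add: post_def bwd_def)
  qed
  let ?T = "\<lambda>j. tv_dist (post (M j) g' n k) (post (M (Suc j)) g' n k)"
  \<comment> \<open>The future after the replaced index is governed by \<open>Q\<close>, which gives
    the rate \<open>r\<close>. The bound \<open>e\<close> is left free because the initial law has
    its own error \<open>\<eta>\<^sub>0\<close>.\<close>
  have early: "?T j \<le> r ^ (k - Suc j) * (2 * e / d)"
    if j: "j < k" and e: "\<And>x u. \<bar>Q j x u - Q' j x u\<bar> \<le> e" for j e
  proof -
    have "?T j \<le> r ^ (k - Suc j) * tv_dist (post (M j) g' n (Suc j)) (post (M (Suc j)) g' n (Suc j))"
      unfolding r_def using j k d by (intro contraction_forward adm_M) (auto simp: M_def)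
    also have "\<dots> \<le> r ^ (k - Suc j) * (2 * e / d)"
      using r j k d e by (intro mult_left_mono transition_change_local(1) adm_M) (auto simp: M_def)
    finally show ?thesis .
  qed
  \<comment> \<open>The reversed kernels between \<open>j\<close> and \<open>k\<close> are built
    from \<open>Q'\<close>, hence the rate \<open>r'\<close>. The local error keeps the constant
    \<open>d\<close>, because \<open>M j\<close> still has \<open>Q\<close> at index
    \<open>j\<close>.\<close>
  have late: "?T j \<le> r' ^ (j - k) * (2 * \<eta> / d)" if j: "k \<le> j" "j < n" for j
  proof -
    have "?T j \<le> r' ^ (j - k) * tv_dist (post (M j) g' n j) (post (M (Suc j)) g' n j)"
      unfolding r'_def using j k d' by (intro contraction_backward adm_M) (auto simp: M_def)
    also have "\<dots> \<le> r' ^ (j - k) * (2 * \<eta> / d)"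
      using r' j k d \<eta> by (intro mult_left_mono transition_change_local(2) adm_M) (auto simp: M_def)
    finally show ?thesis .
  qed
  have e0: "0 \<le> 2 * \<eta> / d" using \<eta>[of 1 undefined undefined] d(1) by simp
  have geometric: "(\<Sum>i<m. q ^ i) \<le> 1 / (1 - q)" if "0 \<le> q" "q < 1" for q :: real and m
    using that sum_gp_strict[of q m] by (simp add: divide_right_mono)
  have split: "{..<n} = insert 0 {1..<k} \<union> {k..<n}" "insert 0 {1..<k} \<inter> {k..<n} = {}"
    using k by auto
  have "tv_dist (post Q g' n k) (post Q' g' n k) \<le> (\<Sum>j<n. ?T j)"
    using tv_dist_telescope[of "\<lambda>j. post (M j) g' n k" n] by (simp add: M0 Mn)
  also have "\<dots> = ?T 0 + (\<Sum>j=1..<k. ?T j) + (\<Sum>j=k..<n. ?T j)"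
    unfolding split(1) by (subst sum.union_disjoint) (use split(2) in auto)
  also have "\<dots> \<le> r ^ (k - 1) * (2 * \<eta>\<^sub>0 / d) + 1 / (1 - r) * (2 * \<eta> / d) + 1 / (1 - r') * (2 * \<eta> / d)"
  proof (intro add_mono)
    show "?T 0 \<le> r ^ (k - 1) * (2 * \<eta>\<^sub>0 / d)" using early[of 0 \<eta>\<^sub>0] k \<eta>0 by simp
    have "(\<Sum>j=1..<k. ?T j) \<le> (\<Sum>j=1..<k. r ^ (k - Suc j) * (2 * \<eta> / d))"
      using \<eta> by (intro sum_mono early) auto
    also have "\<dots> = (\<Sum>i<k - 1. r ^ i) * (2 * \<eta> / d)"
      unfolding sum_distrib_right
      by (rule sum.reindex_bij_witness[of _ "\<lambda>i. k - Suc i" "\<lambda>j. k - Suc j"]) auto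
    also have "\<dots> \<le> 1 / (1 - r) * (2 * \<eta> / d)"
      using e0 r by (intro mult_right_mono geometric)
    finally show "(\<Sum>j=1..<k. ?T j) \<le> 1 / (1 - r) * (2 * \<eta> / d)" .
    have "(\<Sum>j=k..<n. ?T j) \<le> (\<Sum>j=k..<n. r' ^ (j - k) * (2 * \<eta> / d))"
      by (intro sum_mono late) auto
    also have "\<dots> = (\<Sum>i<n - k. r' ^ i) * (2 * \<eta> / d)"
      unfolding sum_distrib_right
      by (rule sum.reindex_bij_witness[of _ "\<lambda>i. i + k" "\<lambda>j. j - k"]) auto
    also have "\<dots> \<le> 1 / (1 - r') * (2 * \<eta> / d)"
      using e0 r' by (intro mult_right_mono geometric)
    finally show "(\<Sum>j=k..<n. ?T j) \<le> 1 / (1 - r') * (2 * \<eta> / d)" .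
  qed
  also have "\<dots> = r ^ (k - 1) * (2 * \<eta>\<^sub>0 / d) + (1 / (1 - r) + 1 / (1 - r')) * (2 * \<eta> / d)"
    by (simp only: distrib_right add.assoc)
  finally have "tv_dist (post Q g' n k) (post Q' g' n k)
      \<le> r ^ (k - 1) * (2 * \<eta>\<^sub>0 / d) + (1 / (1 - r) + 1 / (1 - r')) * (2 * \<eta> / d)" .
  then show ?thesis
    using likelihoods tv_dist_triangle[of "post Q g n k" "post Q' g' n k" "post Q g' n k"] by linarith
qed

subsection \<open>Filtering and smoothing as posterior laws\<close>

definition model_trans :: "real ^ 'k \<Rightarrow> real ^ 'k ^ 'k \<Rightarrow> nat \<Rightarrow> 'k \<Rightarrow> 'k \<Rightarrow> real" where
  "model_trans p Q i x u = (if i = 0 then p $ u else Q $ x $ u)"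

definition model_lik :: "('k \<Rightarrow> real ^ 'd \<Rightarrow> real) \<Rightarrow> (nat \<Rightarrow> real ^ 'd) \<Rightarrow> nat \<Rightarrow> 'k \<Rightarrow> real" where
  "model_lik f y i x = f x (y i)"

text \<open>Each filtering step is homogeneous in the previous weights, so normalizing at every step
  or once at the end gives the same law. The start from the constant 1 at time 0 only adds the
  factor \<open>CARD('k)\<close>, which cancels.\<close>

lemma filt_eq_fwd:
  fixes p :: "real ^ 'k::finite"
  assumes adm: "admissible (model_trans p Q) (model_lik f y) n" and "Suc j \<le> n"
  shows "filt p Q f y (Suc j) x = fwd (model_trans p Q) (model_lik f y) (Suc j) x
    / sum (fwd (model_trans p Q) (model_lik f y) (Suc j)) UNIV"
  using assms(2)
proof (induction j arbitrary: x)
  case 0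
  show ?case
    by (simp add: model_trans_def model_lik_def sum_distrib_left[symmetric] mult.assoc)
next
  case (Suc j)
  define a where "a = fwd (model_trans p Q) (model_lik f y) (Suc j)"
  define A where "A = sum a UNIV"
  have A: "A \<noteq> 0" using fwd_sum_pos[OF adm, of "Suc j"] Suc.prems unfolding A_def a_def by simp
  have IH: "filt p Q f y (Suc j) z = a z / A" for z
    using Suc unfolding A_def a_def by simp
  have step: "fwd (model_trans p Q) (model_lik f y) (Suc (Suc j)) u
      = (\<Sum>z\<in>UNIV. Q $ z $ u * f u (y (Suc (Suc j))) * a z)" for u
    unfolding fwd.simps(2)[of _ _ "Suc j"] a_def[symmetric]
    by (simp add: model_trans_def model_lik_def sum_distrib_left sum_distrib_right mult_ac)
  have num: "(\<Sum>z\<in>UNIV. Q $ z $ u * f u (y (Suc (Suc j))) * filt p Q f y (Suc j) z)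
      = fwd (model_trans p Q) (model_lik f y) (Suc (Suc j)) u / A" for u
    unfolding step IH by (simp add: sum_divide_distrib)
  have "filt_den p Q f y (Suc (Suc j))
      = sum (fwd (model_trans p Q) (model_lik f y) (Suc (Suc j))) UNIV / A"
    unfolding filt_den.simps by (subst sum.swap) (simp only: num sum_divide_distrib)
  then show ?case unfolding filt.simps num using A by simp
qed

text \<open>The normalizing constant of the filter cancels in \<open>back_kernel\<close>, which
  leaves exactly the reversed kernel of \<open>post_backward\<close>. At the horizon the backward
  weight is 1, and smoothing is filtering.\<close>

lemma smooth_eq_post:
  fixes p :: "real ^ 'k::finite"
  assumes adm: "admissible (model_trans p Q) (model_lik f y) n" and k: "1 \<le> k" "k \<le> n"
  shows "smooth p Q f y n k x = post (model_trans p Q) (model_lik f y) n k x"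
  using k(2,1)
proof (induction k arbitrary: x rule: inc_induct)
  case base
  then obtain j where "n = Suc j" by (cases n) auto
  then show ?case
    using filt_eq_fwd[OF adm, of j x]
    by (subst smooth.simps) (simp add: post_def del: fwd.simps filt.simps)
next
  case (step k)
  define a where "a = fwd (model_trans p Q) (model_lik f y) k"
  have A: "sum a UNIV \<noteq> 0"
    unfolding a_def using fwd_sum_pos[OF adm, of k] step by simp
  obtain j where j: "k = Suc j" using step by (cases k) auto
  have filt: "filt p Q f y k z = a z / sum a UNIV" for z
    using filt_eq_fwd[OF adm, of j z] step unfolding j a_def by simp
  have "back_den Q (filt p Q f y k) u = (\<Sum>z\<in>UNIV. a z * Q $ z $ u) / sum a UNIV" for u
    unfolding back_den_def filt by (simp add: sum_divide_distrib mult.commute)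
  then have kernel: "back_kernel Q (filt p Q f y k) u v
      = a v * Q $ v $ u / (\<Sum>z\<in>UNIV. a z * Q $ z $ u)" for u v
    unfolding back_kernel_def using A by (simp add: filt)
  have "smooth p Q f y n k x
      = (\<Sum>u\<in>UNIV. back_kernel Q (filt p Q f y k) u x * post (model_trans p Q) (model_lik f y) n (Suc k) u)"
    using step by (subst smooth.simps) simp
  also have "\<dots> = post (model_trans p Q) (model_lik f y) n k x"
    using step by (subst post_backward[OF adm]) (auto simp: kernel a_def model_trans_def mult_ac)
  finally show ?case .
qed

text \<open>If all likelihoods at some time vanished, so would the filtering denominator at that
  time. The denominator at time 1 yields the compatibility of the initial law with the first
  observation.\<close>

lemma admissible_model:
  fixes p :: "real ^ 'k::finite"
  assumes p: "prob_vec p" and Q: "\<And>x u. 0 < Q $ x $ u" and n: "1 \<le> n"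
    and f: "\<And>l x. l \<in> {1..n} \<Longrightarrow> 0 \<le> f x (y l)"
    and den: "\<And>l. l \<in> {1..n} \<Longrightarrow> 0 < filt_den p Q f y l"
  shows "admissible (model_trans p Q) (model_lik f y) n"
proof -
  have "\<exists>x. 0 < f x (y l)" if l: "l \<in> {1..n}" for l
  proof (rule ccontr)
    assume "\<not> ?thesis"
    then have zero: "f x (y l) = 0" for x using f[OF l, of x] by (metis less_eq_real_def)
    consider "l = Suc 0" | j where "l = Suc (Suc j)"
      using l by (metis Suc_le_D atLeastAtMost_iff not0_implies_Suc One_nat_def)
    then have "filt_den p Q f y l = 0"
      using zero by cases simp_all
    then show False using den[OF l] by simp
  qed
  moreover have "\<exists>u. 0 < p $ u * f u (y 1)"
  proof (rule ccontr)
    assume "\<not> ?thesis"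
    then have "(\<Sum>u\<in>UNIV. p $ u * f u (y 1)) \<le> 0" by (intro sum_nonpos) (auto simp: not_less)
    then show False using den[of 1] n by simp
  qed
  ultimately show ?thesis
    using p Q f unfolding admissible_def model_trans_def model_lik_def prob_vec_def by auto
qed

subsection \<open>The perturbation bound\<close>

lemma finite_entries: "finite {Q $ i $ j | i j. True}" for Q :: "real ^ 'k ^ 'k"
proof -
  have "{Q $ i $ j | i j. True} = range (\<lambda>(i, j). Q $ i $ j)" by auto
  then show ?thesis by simp
qed

lemma min_entry_le: "min_entry Q \<le> Q $ i $ j"
  unfolding min_entry_def by (intro Min_le finite_entries) auto

lemma min_entry_nonneg:
  assumes "transition_matrix Q"
  shows "0 \<le> min_entry Q"
proof -
  have "min_entry Q \<in> {Q $ i $ j | i j. True}"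
    unfolding min_entry_def by (intro Min_in finite_entries) auto
  then show ?thesis using assms unfolding transition_matrix_def prob_vec_def by auto
qed

text \<open>With at least two states, each row has another entry, which is at least the minimum and
  takes its share of the total 1. This is the source of the \<open>1 - d\<close> in the contraction
  rate and of \<open>d \<le> 1/2\<close>.\<close>

lemma entry_le:
  fixes Q :: "real ^ 'k ^ 'k"
  assumes "transition_matrix Q" and "CARD('k) \<ge> 2"
  shows "Q $ i $ j \<le> 1 - min_entry Q"
proof -
  have Q: "\<And>u. 0 \<le> Q $ i $ u" "(\<Sum>u\<in>UNIV. Q $ i $ u) = 1"
    using assms(1) unfolding transition_matrix_def prob_vec_def by auto
  have "UNIV \<noteq> {j}" using assms(2) by (auto dest: arg_cong[of _ _ card])
  then obtain u where u: "u \<noteq> j" by auto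
  have "Q $ i $ j + Q $ i $ u = (\<Sum>v\<in>{j, u}. Q $ i $ v)" using u by auto
  also have "\<dots> \<le> (\<Sum>v\<in>UNIV. Q $ i $ v)" by (intro sum_mono2) (use Q in auto)
  finally show ?thesis using Q min_entry_le[of Q i u] by simp
qed

theorem proposition2p2:
  fixes Q Q_hat :: "real ^ 'k ^ 'k"
    and p p_hat :: "real ^ 'k"
    and f f_hat :: "'k \<Rightarrow> real ^ 'd \<Rightarrow> real"
    and Y :: "(real ^ 'd) set"
    and y :: "nat \<Rightarrow> real ^ 'd"
    and k n :: nat
  assumes "CARD('k) \<ge> 2"
    and "Y \<in> sets lebesgue"
    and "transition_matrix Q" and "prob_vec p" and "\<And>x. prob_density_on Y (f x)"
    and "transition_matrix Q_hat" and "prob_vec p_hat" and "\<And>x z. z \<in> Y \<Longrightarrow> 0 \<le> f_hat x z"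
    and "min_entry Q > 0"
    and "stationary Q p"
    and "1 \<le> k" and "k \<le> n"
    and "\<And>l. l \<in> {1..n} \<Longrightarrow> y l \<in> Y"
    and "denominators_pos p Q f y n"
    and "denominators_pos p_hat Q_hat f_hat y n"
  shows "ereal (tv_dist (smooth p Q f y n k) (smooth p_hat Q_hat f_hat y n k))
    \<le> (if min_entry Q_hat = 0 \<or> (\<exists>l\<in>{1..n}. c_min Q f (y l) = 0) then \<infinity>
       else ereal (4 * (1 - min_entry Q) / min_entry Q *
         (rho Q ^ (k - 1) * norm (p - p_hat) / min_entry Q
          + (1 / (1 - rho Q) + 1 / (1 - rho Q_hat)) * norm (Q - Q_hat) / min_entry Q
          + (\<Sum>l=1..n. max (rho Q_hat) (rho Q) ^ nat \<bar>int l - int k\<bar>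
               * inverse (c_min Q f (y l)) * (MAX x. \<bar>f x (y l) - f_hat x (y l)\<bar>)))))"
proof (cases "min_entry Q_hat = 0 \<or> (\<exists>l\<in>{1..n}. c_min Q f (y l) = 0)")
  case True
  then show ?thesis by simp
next
  case False
  define d d' where "d = min_entry Q" and "d' = min_entry Q_hat"
  define c where "c l = c_min Q f (y l)" for l
  define D where "D l = (MAX x. \<bar>f x (y l) - f_hat x (y l)\<bar>)" for l
  have n: "1 \<le> n" using assms(11,12) by simp
  have d: "0 < d" "\<And>x u. d \<le> Q $ x $ u" "\<And>x u. Q $ x $ u \<le> 1 - d"
    unfolding d_def using assms(9) min_entry_le entry_le[OF assms(3,1)] by auto
  have d': "0 < d'" "\<And>x u. d' \<le> Q_hat $ x $ u" "\<And>x u. Q_hat $ x $ u \<le> 1 - d'"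
    unfolding d'_def using False min_entry_nonneg[OF assms(6)] min_entry_le entry_le[OF assms(6,1)] by auto
  have half: "d \<le> 1/2" "d' \<le> 1/2"
    using d(2,3)[of undefined undefined] d'(2,3)[of undefined undefined] by linarith+
  have Q: "\<And>x. (\<Sum>u\<in>UNIV. Q $ x $ u) = 1"
    using assms(3) unfolding transition_matrix_def prob_vec_def by auto
  have p: "\<And>x. 0 \<le> p $ x" "(\<Sum>x\<in>UNIV. p $ x) = 1"
    using assms(4) unfolding prob_vec_def by auto
  have f: "0 \<le> f x (y l)" if "l \<in> {1..n}" for l x
    using assms(5)[of x] assms(13)[OF that] unfolding prob_density_on_def by auto
  have p_step: "p $ u = (\<Sum>x\<in>UNIV. p $ x * Q $ x $ u)" for u
  proof -
    have "p $ u = (p v* Q) $ u" using assms(10) unfolding stationary_def by simp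
    then show ?thesis by (simp add: vector_matrix_mult_def mult.commute)
  qed
  \<comment> \<open>By stationarity \<open>p\<close> is a mixture of rows of \<open>Q\<close>, so
    its entries obey the same lower bound.\<close>
  have pd: "d \<le> p $ u" for u
  proof -
    have "d = (\<Sum>x\<in>UNIV. p $ x * d)" using p by (simp add: sum_distrib_right[symmetric])
    also have "\<dots> \<le> p $ u" unfolding p_step[of u] using p d by (intro sum_mono mult_left_mono)
    finally show ?thesis .
  qed
  have p_le: "p $ u \<le> 1 - d" for u
  proof -
    have "p $ u \<le> (\<Sum>x\<in>UNIV. p $ x * (1 - d))"
      unfolding p_step[of u] using p d by (intro sum_mono mult_left_mono)
    then show ?thesis using p by (simp add: sum_distrib_right[symmetric])
  qed
  have c_le: "c l \<le> (\<Sum>u\<in>UNIV. Q $ x $ u * f u (y l))" for l x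
    unfolding c_def c_min_def by (intro Min_le) auto
  have c0: "0 < c l" if l: "l \<in> {1..n}" for l
  proof -
    have "c l \<in> range (\<lambda>x. \<Sum>u\<in>UNIV. Q $ x $ u * f u (y l))"
      unfolding c_def c_min_def by (intro Min_in) auto
    then obtain x where "c l = (\<Sum>u\<in>UNIV. Q $ x $ u * f u (y l))" by auto
    moreover have "0 \<le> Q $ x $ u" for u using d(1) d(2)[of x u] by linarith
    ultimately have "0 \<le> c l" using f[OF l] by (simp add: sum_nonneg)
    then show ?thesis using False l unfolding c_def by fastforce
  qed
  \<comment> \<open>The same mixture argument extends the row bound \<open>c_le\<close> to the first
    observation, whose prediction is \<open>p\<close> itself and not a row of
    \<open>Q\<close>.\<close>
  have c_p: "c l \<le> (\<Sum>u\<in>UNIV. p $ u * f u (y l))" for l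
  proof -
    have "c l = (\<Sum>x\<in>UNIV. p $ x * c l)" using p by (simp add: sum_distrib_right[symmetric])
    also have "\<dots> \<le> (\<Sum>x\<in>UNIV. p $ x * (\<Sum>u\<in>UNIV. Q $ x $ u * f u (y l)))"
      using p c_le by (intro sum_mono mult_left_mono)
    also have "\<dots> = (\<Sum>u\<in>UNIV. (\<Sum>x\<in>UNIV. p $ x * Q $ x $ u) * f u (y l))"
      unfolding sum_distrib_left sum_distrib_right by (subst sum.swap) (simp add: mult.assoc)
    also have "\<dots> = (\<Sum>u\<in>UNIV. p $ u * f u (y l))"
      by (simp only: p_step[symmetric])
    finally show ?thesis .
  qed
  have adm: "admissible (model_trans p Q) (model_lik f y) n"
  proof (rule admissible_model[OF assms(4) _ n])
    show "0 < Q $ x $ u" for x u using d(1) d(2)[of x u] by linarith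
  qed (use f assms(14) in \<open>auto simp: denominators_pos_def\<close>)
  have adm': "admissible (model_trans p_hat Q_hat) (model_lik f_hat y) n"
  proof (rule admissible_model[OF assms(7) _ n])
    show "0 < Q_hat $ x $ u" for x u using d'(1) d'(2)[of x u] by linarith
  qed (use assms(8,13,15) in \<open>auto simp: denominators_pos_def\<close>)
  let ?E = "\<lambda>l. nat \<bar>int l - int k\<bar>"
  have bound: "tv_dist (smooth p Q f y n k) (smooth p_hat Q_hat f_hat y n k)
    \<le> (\<Sum>l=1..n. rho Q ^ ?E l * (2 * ((1 - d) / d) * D l / c l))
      + (rho Q ^ (k - 1) * (2 * norm (p - p_hat) / d)
      + (1 / (1 - rho Q) + 1 / (1 - rho Q_hat)) * (2 * norm (Q - Q_hat) / d))"
  proof -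
    have rho: "rho Q = 1 - d / (1 - d)" "rho Q_hat = 1 - d' / (1 - d')"
      by (simp_all add: rho_def d_def d'_def)
    have "tv_dist (post (model_trans p Q) (model_lik f y) n k)
        (post (model_trans p_hat Q_hat) (model_lik f_hat y) n k)
      \<le> (\<Sum>l=1..n. rho Q ^ ?E l * (2 * ((1 - d) / d) * D l / c l))
      + (rho Q ^ (k - 1) * (2 * norm (p - p_hat) / d)
      + (1 / (1 - rho Q) + 1 / (1 - rho Q_hat)) * (2 * norm (Q - Q_hat) / d))"
      unfolding rho
    proof (rule post_perturbation[OF adm adm' assms(11,12)])
      show "(\<Sum>u\<in>UNIV. model_trans p Q i x u) = 1" for i x
        using Q p by (cases "i = 0") (simp_all add: model_trans_def)
    next
      fix l x assume l: "l \<in> {1..n}"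
      show "0 < c l" by (rule c0[OF l])
      show "c l \<le> (\<Sum>u\<in>UNIV. model_trans p Q (l - 1) x u * model_lik f y l u)"
        using c_p[of l] c_le[of l x] by (cases "l \<le> 1") (simp_all add: model_trans_def model_lik_def)
      show "\<bar>model_lik f y l x - model_lik f_hat y l x\<bar> \<le> D l"
        unfolding D_def model_lik_def by (intro Max_ge) auto
    next
      fix x u
      \<comment> \<open>Only differences of single entries enter the perturbation bound; here and
        below they are dominated by the Euclidean and the Frobenius norm.\<close>
      show "\<bar>model_trans p Q 0 x u - model_trans p_hat Q_hat 0 x u\<bar> \<le> norm (p - p_hat)"
        using component_le_norm_cart[of "p - p_hat" u] by (simp add: model_trans_def)
    next
      fix i x u assume i: "1 \<le> (i::nat)"
      have "\<bar>(Q - Q_hat) $ x $ u\<bar> \<le> norm ((Q - Q_hat) $ x)" by (rule component_le_norm_cart)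
      also have "\<dots> \<le> norm (Q - Q_hat)" by (rule Finite_Cartesian_Product.norm_nth_le)
      finally show "\<bar>model_trans p Q i x u - model_trans p_hat Q_hat i x u\<bar> \<le> norm (Q - Q_hat)"
        using i by (simp add: model_trans_def)
    qed (use half d d' Q p pd p_le in \<open>auto simp: model_trans_def\<close>)
    moreover have "smooth p Q f y n k = post (model_trans p Q) (model_lik f y) n k"
      "smooth p_hat Q_hat f_hat y n k = post (model_trans p_hat Q_hat) (model_lik f_hat y) n k"
      using smooth_eq_post[OF adm assms(11,12)] smooth_eq_post[OF adm' assms(11,12)] by auto
    ultimately show ?thesis by simp
  qed
  define C where "C = 4 * (1 - d) / d"
  \<comment> \<open>This follows from \<open>d \<le> 1/2\<close>; it absorbs the factor 2 of the
    initial law and transition terms into \<open>C\<close>.\<close>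
  have C: "2 \<le> C" "0 \<le> C" using d(1) half(1) by (simp_all add: C_def field_simps)
  have r: "0 \<le> rho Q" "rho Q < 1" "rho Q_hat < 1"
    using d(1) d'(1) half unfolding rho_def d_def d'_def by (simp_all add: field_simps)
  have D0: "0 \<le> D l" for l
  proof -
    have "\<bar>f undefined (y l) - f_hat undefined (y l)\<bar> \<le> D l"
      unfolding D_def by (intro Max_ge) auto
    then show ?thesis by linarith
  qed
  note bound
  also have "(\<Sum>l=1..n. rho Q ^ ?E l * (2 * ((1 - d) / d) * D l / c l))
      \<le> (\<Sum>l=1..n. C * (max (rho Q_hat) (rho Q) ^ ?E l * inverse (c l) * D l))"
  proof (rule sum_mono)
    fix l assume l: "l \<in> {1..n}"
    have "rho Q ^ ?E l * (2 * ((1 - d) / d) * D l / c l) = C / 2 * (rho Q ^ ?E l * inverse (c l) * D l)"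
    proof -
      have C2: "2 * ((1 - d) / d) = C / 2" using d(1) by (simp add: C_def field_simps)
      show ?thesis unfolding C2 by (simp only: divide_inverse mult_ac)
    qed
    also have "\<dots> \<le> C * (max (rho Q_hat) (rho Q) ^ ?E l * inverse (c l) * D l)"
      \<comment> \<open>The constant grows from \<open>C / 2\<close> to \<open>C\<close> and the
        rate from \<open>rho Q\<close> to the maximum; the latter is monotone in the power because
        \<open>rho Q\<close> is nonnegative.\<close>
      using C r D0[of l] c0[OF l] by (intro mult_mono power_mono mult_nonneg_nonneg) auto
    finally show "rho Q ^ ?E l * (2 * ((1 - d) / d) * D l / c l)
        \<le> C * (max (rho Q_hat) (rho Q) ^ ?E l * inverse (c l) * D l)" .
  qed
  also have "rho Q ^ (k - 1) * (2 * norm (p - p_hat) / d)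
      + (1 / (1 - rho Q) + 1 / (1 - rho Q_hat)) * (2 * norm (Q - Q_hat) / d)
      = 2 * (rho Q ^ (k - 1) * norm (p - p_hat) / d
        + (1 / (1 - rho Q) + 1 / (1 - rho Q_hat)) * norm (Q - Q_hat) / d)"
    by (simp only: distrib_left times_divide_eq_right mult.left_commute[of 2])
  also have "\<dots> \<le> C * (rho Q ^ (k - 1) * norm (p - p_hat) / d
        + (1 / (1 - rho Q) + 1 / (1 - rho Q_hat)) * norm (Q - Q_hat) / d)"
    using C r d(1) by (intro mult_right_mono add_nonneg_nonneg divide_nonneg_pos mult_nonneg_nonneg) auto
  finally have "tv_dist (smooth p Q f y n k) (smooth p_hat Q_hat f_hat y n k)
    \<le> C * (rho Q ^ (k - 1) * norm (p - p_hat) / d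
        + (1 / (1 - rho Q) + 1 / (1 - rho Q_hat)) * norm (Q - Q_hat) / d
        + (\<Sum>l=1..n. max (rho Q_hat) (rho Q) ^ ?E l * inverse (c l) * D l))"
    by (simp add: distrib_left sum_distrib_left add_ac)
  then show ?thesis using False unfolding C_def d_def c_def D_def by auto
qed

end
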